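(* Let $(A_n,B_n)_{n\ge2}$, $A_n=(a_n(m,k))_{1\le m,k\le n}$, $B_n=(b_n(m,k))_{1\le m,k\le n}$, be the twin Seidel matrix sequence. Then for every $n\ge2$ and all $1\le m,k\le n$: $$a_n(m,k)=\#\{w\in \mathrm{And}_n^{I}:\ (\mathbf{F}\,w,\mathbf{NL}\,w)=(m,k)\},\qquad b_n(m,k)=\#\{w\in \mathrm{And}_n^{II}:\ (\mathbf{L}\,w,\mathbf{grn}\,w)=(m,k)\}.$$
   Context: Andr\'e permutations: words $w=x_1\cdots x_n$ are permutations of a finite set $Y$ of positive integers; the empty word and every one-letter word are Andr\'e I and Andr\'e II. For $|Y|\ge2$ write $w=v\,\min(w)\,v'$; $w$ is Andr\'e I (resp. II) if $v,v'$ are Andr\'e I (resp. II) and $\max(vv')$ (resp. $\min(vv')$) is a letter of $v'$. $\mathrm{And}_n^{I}$, $\mathrm{And}_n^{II}$: Andr\'e I, II permutations of $\{1,\dots,n\}$. $\mathbf{F}\,w=x_1$, $\mathbf{L}\,w=x_n$, $\mathbf{NL}\,w=x_{n-1}$, $\mathbf{grn}\,w=\max\{x_{i-1},x_{i+1}\}$ where $x_i=n$, with $x_0=x_{n+1}=0$. Twin Seidel matrix sequence: the unique sequence of square matrices $A_n=(a_n(m,k))$, $B_n=(b_n(m,k))$ of dimension $n$ ($n\ge2$) with nonnegative integer entries satisfying, with $a_n(m,\bullet)=\sum_k a_n(m,k)$, $a_n(\bullet,k)=\sum_m a_n(m,k)$ and similarly for $b$: (TS1) all diagonal entries of all $A_n,B_n$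 are $0$, except $a_2(1,1)=1$; (TS2) for $n\ge3$: $a_n(m,n)=b_n(m,n)=0$ for all $m$, $a_n(n,k)=b_n(1,k)=0$ for all $k$, and $b_n(n,1)=0$; (TS3) $A_2=\begin{pmatrix}1&0\\0&0\end{pmatrix}$, $B_2=\begin{pmatrix}0&0\\1&0\end{pmatrix}$; (TS4) for $n\ge3$: $b_n(n,k)=a_{n-1}(\bullet,k-1)$ for $2\le k\le n-1$; $b_n(n-1,k)=a_{n-1}(\bullet,k)$ for $1\le k\le n-2$; $b_n(m+1,k)-b_n(m,k)=a_{n-1}(m,k)$ for $2\le k+1\le m\le n-2$; $b_n(m+1,k)-b_n(m,k)=a_{n-1}(m,k-1)$ for $3\le m+2\le k\le n-1$; (TS5) for $n\ge3$: $a_n(1,k)=b_{n-1}(\bullet,k-1)$ for $2\le k\le n-1$; $a_n(m+1,k)-a_n(m,k)=-b_{n-1}(m,k-1)$ for $3\le m+2\le k\le n-1$; $a_n(m+1,k)-a_n(m,k)=-b_{n-1}(m,k)$ for $2\le k+1\le m\le n-1$. *)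

theory Defs
  imports Main "HOL-Combinatorics.Multiset_Permutations"
begin

text \<open>Andre words: words with distinct letters are
  lists, and the pivot \<open>x\<close> in \<open>v @ x # v'\<close> is the least letter of the word.\<close>

inductive andre_I :: "nat list \<Rightarrow> bool" where
  andre_I_Nil: "andre_I []"
| andre_I_single: "andre_I [x]"
| andre_I_split:
    "distinct (v @ x # v') \<Longrightarrow> v @ v' \<noteq> [] \<Longrightarrow> x = Min (set (v @ x # v')) \<Longrightarrow>
     andre_I v \<Longrightarrow> andre_I v' \<Longrightarrow> Max (set (v @ v')) \<in> set v' \<Longrightarrow> andre_I (v @ x # v')"

inductive andre_II :: "nat list \<Rightarrow> bool" where
  andre_II_Nil: "andre_II []"
| andre_II_single: "andre_II [x]"
| andre_II_split:
    "distinct (v @ x # v') \<Longrightarrow> v @ v' \<noteq> [] \<Longrightarrow> x = Min (set (v @ x # v')) \<Longrightarrow>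
     andre_II v \<Longrightarrow> andre_II v' \<Longrightarrow> Min (set (v @ v')) \<in> set v' \<Longrightarrow> andre_II (v @ x # v')"

definition And_I :: "nat \<Rightarrow> nat list set" where
  "And_I n = {w \<in> permutations_of_set {1..n}. andre_I w}"

definition And_II :: "nat \<Rightarrow> nat list set" where
  "And_II n = {w \<in> permutations_of_set {1..n}. andre_II w}"

text \<open>\<open>letter w i\<close> is the 1-based letter \<open>x\<^sub>i\<close>, extended by \<open>x\<^sub>0 = x\<^sub>n\<^sub>+\<^sub>1 = 0\<close>.\<close>

definition letter :: "nat list \<Rightarrow> nat \<Rightarrow> nat" where
  "letter w i = (if 1 \<le> i \<and> i \<le> length w then w ! (i - 1) else 0)"

definition F_stat :: "nat list \<Rightarrow> nat" where
  "F_stat w = letter w 1"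

definition L_stat :: "nat list \<Rightarrow> nat" where
  "L_stat w = letter w (length w)"

definition NL_stat :: "nat list \<Rightarrow> nat" where
  "NL_stat w = letter w (length w - 1)"

text \<open>Meant for permutations of \<open>{1..n}\<close>, where \<open>n = length w\<close> is the greatest letter and occurs
  at exactly one position.\<close>

definition grn :: "nat list \<Rightarrow> nat" where
  "grn w = (let i = (THE i. 1 \<le> i \<and> i \<le> length w \<and> letter w i = length w)
            in max (letter w (i - 1)) (letter w (i + 1)))"

text \<open>A sequence of square matrices of varying dimension is a function \<open>M\<close>, where \<open>M n m k\<close> is the
  \<open>(m, k)\<close> entry of the \<open>n\<close>-th matrix and is only meaningful for \<open>n \<ge> 2\<close> and \<open>1 \<le> m, k \<le> n\<close>.
  Differences of entries are taken in the integers, so nothing is truncated.\<close>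

type_synonym matrix_seq = "nat \<Rightarrow> nat \<Rightarrow> nat \<Rightarrow> nat"

definition col_sum :: "matrix_seq \<Rightarrow> nat \<Rightarrow> nat \<Rightarrow> nat" where
  "col_sum M n k = (\<Sum>m = 1..n. M n m k)"

definition TS1 :: "matrix_seq \<Rightarrow> matrix_seq \<Rightarrow> bool" where
  "TS1 a b \<longleftrightarrow>
     (\<forall>n\<ge>2. \<forall>m\<in>{1..n}. a n m m = (if n = 2 \<and> m = 1 then 1 else 0) \<and> b n m m = 0)"

definition TS2 :: "matrix_seq \<Rightarrow> matrix_seq \<Rightarrow> bool" where
  "TS2 a b \<longleftrightarrow>
     (\<forall>n\<ge>3. (\<forall>m\<in>{1..n}. a n m n = 0 \<and> b n m n = 0) \<and>
             (\<forall>k\<in>{1..n}. a n n k = 0 \<and> b n 1 k = 0) \<and>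
             b n n 1 = 0)"

definition TS3 :: "matrix_seq \<Rightarrow> matrix_seq \<Rightarrow> bool" where
  "TS3 a b \<longleftrightarrow>
     a 2 1 1 = 1 \<and> a 2 1 2 = 0 \<and> a 2 2 1 = 0 \<and> a 2 2 2 = 0 \<and>
     b 2 1 1 = 0 \<and> b 2 1 2 = 0 \<and> b 2 2 1 = 1 \<and> b 2 2 2 = 0"

definition TS4 :: "matrix_seq \<Rightarrow> matrix_seq \<Rightarrow> bool" where
  "TS4 a b \<longleftrightarrow>
     (\<forall>n\<ge>3.
        (\<forall>k. 2 \<le> k \<and> k \<le> n - 1 \<longrightarrow> b n n k = col_sum a (n - 1) (k - 1)) \<and>
        (\<forall>k. 1 \<le> k \<and> k \<le> n - 2 \<longrightarrow> b n (n - 1) k = col_sum a (n - 1) k) \<and>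
        (\<forall>m k. 2 \<le> k + 1 \<and> k + 1 \<le> m \<and> m \<le> n - 2 \<longrightarrow>
           int (b n (m + 1) k) - int (b n m k) = int (a (n - 1) m k)) \<and>
        (\<forall>m k. 3 \<le> m + 2 \<and> m + 2 \<le> k \<and> k \<le> n - 1 \<longrightarrow>
           int (b n (m + 1) k) - int (b n m k) = int (a (n - 1) m (k - 1))))"

definition TS5 :: "matrix_seq \<Rightarrow> matrix_seq \<Rightarrow> bool" where
  "TS5 a b \<longleftrightarrow>
     (\<forall>n\<ge>3.
        (\<forall>k. 2 \<le> k \<and> k \<le> n - 1 \<longrightarrow> a n 1 k = col_sum b (n - 1) (k - 1)) \<and>
        (\<forall>m k. 3 \<le> m + 2 \<and> m + 2 \<le> k \<and> k \<le> n - 1 \<longrightarrow>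
           int (a n (m + 1) k) - int (a n m k) = - int (b (n - 1) m (k - 1))) \<and>
        (\<forall>m k. 2 \<le> k + 1 \<and> k + 1 \<le> m \<and> m \<le> n - 1 \<longrightarrow>
           int (a n (m + 1) k) - int (a n m k) = - int (b (n - 1) m k)))"

definition twin_seidel :: "matrix_seq \<Rightarrow> matrix_seq \<Rightarrow> bool" where
  "twin_seidel a b \<longleftrightarrow> TS1 a b \<and> TS2 a b \<and> TS3 a b \<and> TS4 a b \<and> TS5 a b"

end

theory Submission imports Defs begin

text \<open>In the direct recurrence for last letters the right block must contain the least
  remaining letter, so the greatest letter, and with it the parent condition, can fall on either
  side. In the first-letter recurrence and in the rotated one it always falls on the right block,
  while the left block carries only the condition on \<open>m\<close>. A difference of two entries
  therefore leaves terms whose left factor has no parent condition, and an induction with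
  \<open>K = UNIV\<close> is enough. In that induction \<open>y\<close> can be the greatest letter
  of a left block without being the greatest letter of the whole set; this is why
  \<open>fc_diff\<close> and \<open>lc_diff\<close> admit \<open>y = Max Y\<close>, while the
  versions with a parent condition exclude it.

  The correction term lives on \<open>Y - {y}\<close>, in general no interval. Renaming it back to
  an interval produces the two cases \<open>k\<close> and \<open>k - 1\<close> in the difference
  relations.\<close>

text \<open>A word with least letter \<open>r\<close> is a binary tree with root \<open>r\<close> whose subtrees are the words to
  the left and to the right of \<open>r\<close>. Andre I and II words are two ways of ordering the children in
  the same increasing trees with at most two children per node, and the greater neighbour of the
  greatest letter is its parent in the tree. Splitting at the root gives recurrences for all the
  counts, indexed by finite sets of letters. A rotation of the subtrees hanging off the path to the
  greatest letter (\<open>last_count_rotate\<close>) turns the recurrence for Andre II words by last letter into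
  the shape of the one for Andre I words by first letter. Exchanging two consecutive letters
  \<open>x < y\<close> then cancels all terms of the difference of two neighbouring entries except those with
  \<open>x\<close> and \<open>y\<close> in the same subtree, and these are handled by induction. The relations obtained in
  this way determine the matrices.\<close>

subsection \<open>Splitting words at the least letter\<close>

text \<open>The two kinds of words differ only in which letter is forced to the right of the pivot.
  With \<open>sel\<close> equal to \<open>Max\<close> or \<open>Min\<close> the splitting theory is
  developed once for both.\<close>

inductive andre_by :: "(nat set \<Rightarrow> nat) \<Rightarrow> nat list \<Rightarrow> bool" for sel where
  Nil: "andre_by sel []"
| single: "andre_by sel [x]"
| split: "distinct (v @ x # v') \<Longrightarrow> v @ v' \<noteq> [] \<Longrightarrow> x = Min (set (v @ x # v')) \<Longrightarrow>
     andre_by sel v \<Longrightarrow> andre_by sel v' \<Longrightarrow> sel (set (v @ v')) \<in> set v' \<Longrightarrow>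
     andre_by sel (v @ x # v')"

lemma andre_I_eq: "andre_I w \<longleftrightarrow> andre_by Max w"
proof
  show "andre_I w \<Longrightarrow> andre_by Max w"
    by (induction rule: andre_I.induct) (auto intro: andre_by.intros)
  show "andre_by Max w \<Longrightarrow> andre_I w"
    by (induction rule: andre_by.induct) (auto intro: andre_I.intros)
qed

lemma andre_II_eq: "andre_II w \<longleftrightarrow> andre_by Min w"
proof
  show "andre_II w \<Longrightarrow> andre_by Min w"
    by (induction rule: andre_II.induct) (auto intro: andre_by.intros)
  show "andre_by Min w \<Longrightarrow> andre_II w"
    by (induction rule: andre_by.induct) (auto intro: andre_II.intros)
qed

definition andre_words :: "(nat set \<Rightarrow> nat) \<Rightarrow> nat set \<Rightarrow> nat list set" where
  "andre_words sel Y = {w. set w = Y \<and> distinct w \<and> andre_by sel w}"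

lemma finite_andre_words [simp]: "finite (andre_words sel Y)"
proof (cases "finite Y")
  case True
  have "andre_words sel Y \<subseteq> permutations_of_set Y"
    by (auto simp: andre_words_def permutations_of_set_def)
  then show ?thesis
    using True finite_permutations_of_set finite_subset by blast
next
  case False
  then have "andre_words sel Y = {}"
    by (auto simp: andre_words_def)
  then show ?thesis by simp
qed

lemma andre_words_empty [simp]: "andre_words sel {} = {[]}"
  by (auto simp: andre_words_def intro: andre_by.Nil)

lemma andre_words_singleton [simp]: "andre_words sel {x} = {[x]}"
proof -
  have "w = [x]" if "set w = {x}" "distinct w" for w
    using that by (cases w; cases "tl w") auto
  then show ?thesis
    by (auto simp: andre_words_def intro: andre_by.single)
qed

lemma andre_by_split_iff:
  assumes "distinct (v @ x # v')" "v @ v' \<noteq> []" "x = Min (set (v @ x # v'))"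
  shows "andre_by sel (v @ x # v') \<longleftrightarrow>
           andre_by sel v \<and> andre_by sel v' \<and> sel (set (v @ v')) \<in> set v'"
proof
  assume "andre_by sel (v @ x # v')"
  then show "andre_by sel v \<and> andre_by sel v' \<and> sel (set (v @ v')) \<in> set v'"
  proof cases
    case Nil
    then show ?thesis by simp
  next
    case (single y)
    then show ?thesis using assms(2) by (cases v) auto
  next
    case (split u y u')
    have "x = y"
      using split(1,4) assms(3) by metis
    moreover have x: "x \<notin> set v" "x \<notin> set v'"
      using assms(1) by simp_all
    ultimately have "v = u \<and> v' = u'"
      using append_Cons_eq_iff[of x v v' u u'] split(1) x by simp
    then show ?thesis using split by simp
  qed
next
  assume "andre_by sel v \<and> andre_by sel v' \<and> sel (set (v @ v')) \<in> set v'"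
  then show "andre_by sel (v @ x # v')"
    using assms by (intro andre_by.split) auto
qed

text \<open>Since \<open>r\<close> occurs only once, both blocks can be read off the word. The
  selection condition says exactly that \<open>sel R\<close> is not in the left block, hence the
  range \<open>Pow (R - {sel R})\<close>.\<close>

lemma bij_betw_andre_words:
  assumes "finite R" "R \<noteq> {}" and less: "\<And>x. x \<in> R \<Longrightarrow> r < x" and sel: "sel R \<in> R"
  shows "bij_betw (\<lambda>(A, v, v'). v @ r # v')
           (SIGMA A : Pow (R - {sel R}). andre_words sel A \<times> andre_words sel (R - A))
           (andre_words sel (insert r R))"
proof -
  let ?f = "\<lambda>(A :: nat set, v, v'). v @ r # v'"
  let ?S = "SIGMA A : Pow (R - {sel R}). andre_words sel A \<times> andre_words sel (R - A)"
  have r: "r \<notin> R" using less by blast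
  have Min: "Min (insert r R) = r"
    using less assms(1) by (intro Min_eqI) (auto intro: less_imp_le)
  have inj: "inj_on ?f ?S"
  proof (rule inj_onI, clarify)
    fix A v v' B u u'
    assume A: "A \<subseteq> R - {sel R}" "B \<subseteq> R - {sel R}" and
      w: "v \<in> andre_words sel A" "u \<in> andre_words sel B"
         "v' \<in> andre_words sel (R - A)" "u' \<in> andre_words sel (R - B)"
      and eq: "v @ r # v' = u @ r # u'"
    have "r \<notin> set v" "r \<notin> set u"  "r \<notin> set v'" "r \<notin> set u'"
      using A w r by (auto simp: andre_words_def)
    then have "v = u \<and> v' = u'"
      using eq by (simp add: append_Cons_eq_iff)
    moreover have "A = set v" "B = set u" using w by (auto simp: andre_words_def)
    ultimately show "A = B \<and> (v, v') = (u, u')" by simp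
  qed
  have key: "v @ r # v' \<in> andre_words sel (insert r R) \<longleftrightarrow>
      v \<in> andre_words sel (set v) \<and> v' \<in> andre_words sel (R - set v) \<and> set v \<subseteq> R - {sel R}"
    for v v'
  proof (cases "distinct (v @ r # v') \<and> set v \<union> set v' = R")
    case True
    have Y: "set (v @ r # v') = insert r R" using True by auto
    have ne: "v @ v' \<noteq> []" using True assms(2) by auto
    have R: "set (v @ v') = R" using True by simp
    have v': "set v' = R - set v" using True by auto
    have "andre_by sel (v @ r # v') \<longleftrightarrow> andre_by sel v \<and> andre_by sel v' \<and> sel R \<in> set v'"
      using andre_by_split_iff[of v r v' sel] True ne unfolding Y Min R by blast
    moreover have "sel R \<in> set v' \<longleftrightarrow> set v \<subseteq> R - {sel R}"
      using v' sel True by blast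
    ultimately show ?thesis
      using True v' Y r unfolding andre_words_def by simp
  next
    case False
    have "v @ r # v' \<notin> andre_words sel (insert r R)"
    proof
      assume "v @ r # v' \<in> andre_words sel (insert r R)"
      then have w: "insert r (set v \<union> set v') = insert r R" "distinct (v @ r # v')"
        by (simp_all add: andre_words_def)
      then have "r \<notin> set v \<union> set v'" by simp
      then have "set v \<union> set v' = R" using w(1) r insert_ident by metis
      then show False using w(2) False by blast
    qed
    moreover have False if "v \<in> andre_words sel (set v)" "v' \<in> andre_words sel (R - set v)"
      "set v \<subseteq> R - {sel R}"
    proof -
      have "set v' = R - set v" "distinct v" "distinct v'"
        using that by (simp_all add: andre_words_def)
      moreover have "set v \<union> (R - set v) = R" "r \<notin> set v" using that(3) r by blast+
      ultimately show False using False r by simp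
    qed
    ultimately show ?thesis by blast
  qed
  have "?f ` ?S = andre_words sel (insert r R)"
  proof (intro equalityI subsetI)
    fix w assume "w \<in> ?f ` ?S"
    then obtain A v v' where *: "w = v @ r # v'" "A \<subseteq> R - {sel R}"
      "v \<in> andre_words sel A" "v' \<in> andre_words sel (R - A)" by auto
    then have "A = set v" by (auto simp: andre_words_def)
    then show "w \<in> andre_words sel (insert r R)" using * key by blast
  next
    fix w assume w: "w \<in> andre_words sel (insert r R)"
    then have "r \<in> set w" by (auto simp: andre_words_def)
    then obtain v v' where "w = v @ r # v'" by (meson split_list)
    then have "(set v, v, v') \<in> ?S" "w = ?f (set v, v, v')"
      using key[of v v'] w by auto
    then show "w \<in> ?f ` ?S" by (rule rev_image_eqI)
  qed
  then show ?thesis using inj by (simp add: bij_betw_def)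
qed

text \<open>\<open>P\<close> and \<open>Q\<close> depend on \<open>A\<close> because it is
  \<open>A\<close> that decides which block holds the greatest letter and so which of the two
  factors inherits the parent condition.\<close>

lemma card_andre_words_split:
  assumes "finite R" "R \<noteq> {}" and less: "\<And>x. x \<in> R \<Longrightarrow> r < x" and sel: "sel R \<in> R"
    and PQ: "\<And>A v v'. A \<subseteq> R - {sel R} \<Longrightarrow> v \<in> andre_words sel A \<Longrightarrow>
            v' \<in> andre_words sel (R - A) \<Longrightarrow> S (v @ r # v') \<longleftrightarrow> P A v \<and> Q A v'"
  shows "card {w \<in> andre_words sel (insert r R). S w} =
    (\<Sum>A\<in>Pow (R - {sel R}). card {v \<in> andre_words sel A. P A v} *
                            card {v' \<in> andre_words sel (R - A). Q A v'})"
proof -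
  let ?f = "\<lambda>(A :: nat set, v, v'). v @ r # v'"
  let ?S = "SIGMA A : Pow (R - {sel R}). andre_words sel A \<times> andre_words sel (R - A)"
  let ?T = "SIGMA A : Pow (R - {sel R}). {v \<in> andre_words sel A. P A v} \<times>
                            {v' \<in> andre_words sel (R - A). Q A v'}"
  have bij: "bij_betw ?f ?S (andre_words sel (insert r R))"
    using assms(1-4) by (rule bij_betw_andre_words)
  have T: "?T = {t \<in> ?S. S (?f t)}" using PQ by auto
  then have "?f ` ?T = {w \<in> ?f ` ?S. S w}" by blast
  then have im: "?f ` ?T = {w \<in> andre_words sel (insert r R). S w}"
    using bij by (simp add: bij_betw_def)
  have "inj_on ?f ?T"
    unfolding T using bij by (auto simp: bij_betw_def intro: inj_on_subset)
  then have "card {w \<in> andre_words sel (insert r R). S w} = card ?T"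
    unfolding im [symmetric] by (rule card_image)
  also have "\<dots> = (\<Sum>A\<in>Pow (R - {sel R}). card {v \<in> andre_words sel A. P A v} *
                            card {v' \<in> andre_words sel (R - A). Q A v'})"
    using assms(1) by (subst card_SigmaI) (simp_all add: card_cartesian_product)
  finally show ?thesis .
qed

text \<open>In the increasing binary tree of a word the greater neighbour of the greatest letter \<open>N\<close>
  is its parent; the default \<open>s\<close> stands for the parent of the whole tree.\<close>

definition nbr :: "nat \<Rightarrow> nat \<Rightarrow> nat list \<Rightarrow> nat" where
  "nbr s N w = max (last (s # takeWhile (\<lambda>x. x \<noteq> N) w)) (hd (tl (dropWhile (\<lambda>x. x \<noteq> N) w) @ [s]))"

lemma nbr_append: "N \<notin> set p \<Longrightarrow> nbr s N (p @ N # q) = max (last (s # p)) (hd (q @ [s]))"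
proof -
  assume "N \<notin> set p"
  then have "takeWhile (\<lambda>x. x \<noteq> N) (p @ N # q) = p" "dropWhile (\<lambda>x. x \<noteq> N) (p @ N # q) = N # q"
    by (subst takeWhile_append2 dropWhile_append2; auto)+
  then show ?thesis by (simp add: nbr_def)
qed

lemma nbr_singleton [simp]: "nbr s N [N] = s"
  by (simp add: nbr_def)

text \<open>Inside its block \<open>N\<close> has a neighbour that is either \<open>r\<close> itself
  or a letter above \<open>r\<close>. Raising the other, possibly missing, neighbour from
  \<open>s\<close> to \<open>r\<close> therefore does not change the maximum. On trees: a subtree
  cut off below \<open>r\<close> remembers \<open>r\<close> as the parent of its root.\<close>

lemma nbr_join:
  assumes d: "distinct (v @ r # v')" and N: "N \<in> set v \<union> set v'" and "s \<le> r"
    and less: "\<And>x. x \<in> set v \<union> set v' \<Longrightarrow> r < x"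
  shows "nbr s N (v @ r # v') = (if N \<in> set v then nbr r N v else nbr r N v')"
proof (cases "N \<in> set v")
  case True
  then obtain p q where v: "v = p @ N # q" by (meson split_list)
  have p: "N \<notin> set p" using d v by auto
  have lp: "p \<noteq> [] \<Longrightarrow> r < last p" using less v by auto
  have hq: "q \<noteq> [] \<Longrightarrow> r < hd q" using less v by auto
  have "nbr s N (v @ r # v') = max (last (s # p)) (hd ((q @ r # v') @ [s]))"
    unfolding v using nbr_append[OF p, of s "q @ r # v'"] by simp
  also have "\<dots> = max (last (r # p)) (hd (q @ [r]))"
    using lp hq \<open>s \<le> r\<close> by (cases q) (auto simp: max_def)
  also have "\<dots> = nbr r N v" unfolding v using nbr_append[OF p] by simp
  finally show ?thesis using True by simp
next
  case False
  then have "N \<in> set v'" using N by auto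
  then obtain p q where v: "v' = p @ N # q" by (meson split_list)
  have p: "N \<notin> set p" using d v by auto
  have p': "N \<notin> set (v @ r # p)" using False p d v by auto
  have lp: "p \<noteq> [] \<Longrightarrow> r < last p" using less v by auto
  have hq: "q \<noteq> [] \<Longrightarrow> r < hd q" using less v by auto
  have "nbr s N (v @ r # v') = max (last (s # v @ r # p)) (hd (q @ [s]))"
    unfolding v using nbr_append[OF p', of s q] by simp
  also have "\<dots> = max (last (r # p)) (hd (q @ [r]))"
    using lp hq \<open>s \<le> r\<close> by (cases q) (auto simp: max_def)
  also have "\<dots> = nbr r N v'" unfolding v using nbr_append[OF p] by simp
  finally show ?thesis using False by simp
qed

lemma nbr_mem:
  assumes "distinct w" "N \<in> set w"
  shows "nbr s N w \<in> insert s (set w - {N})"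
proof -
  obtain p q where w: "w = p @ N # q" using assms(2) by (meson split_list)
  have N: "N \<notin> set p" "N \<notin> set q" using assms w by auto
  have "last (s # p) \<in> insert s (set p)" by auto
  moreover have "hd (q @ [s]) \<in> insert s (set q)" by (cases q) auto
  ultimately have "max (last (s # p)) (hd (q @ [s])) \<in> insert s (set p \<union> set q)"
    by (auto simp: max_def)
  then show ?thesis using N by (auto simp: w nbr_append)
qed

subsection \<open>Counting words by first letter, last letter and parent of the greatest letter\<close>

text \<open>A set \<open>K\<close> of admissible parents covers matrix entries (\<open>{k}\<close>)
  and unrestricted counts (\<open>UNIV\<close>) alike. Exchanging letters \<open>x\<close> and
  \<open>y\<close> then only asks that \<open>K\<close> contain both or neither.\<close>

definition par_count :: "(nat set \<Rightarrow> nat) \<Rightarrow> nat \<Rightarrow> nat set \<Rightarrow> nat set \<Rightarrow> nat" where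
  "par_count sel s Y K = card {w \<in> andre_words sel Y. nbr s (Max Y) w \<in> K}"

definition first_count :: "nat \<Rightarrow> nat set \<Rightarrow> nat \<Rightarrow> nat set \<Rightarrow> nat" where
  "first_count s Y m K = card {w \<in> andre_words Max Y. w \<noteq> [] \<and> hd w = m \<and> nbr s (Max Y) w \<in> K}"

definition last_count :: "nat \<Rightarrow> nat set \<Rightarrow> nat \<Rightarrow> nat set \<Rightarrow> nat" where
  "last_count s Y m K = card {w \<in> andre_words Min Y. w \<noteq> [] \<and> last w = m \<and> nbr s (Max Y) w \<in> K}"

text \<open>Both blocks of a word with least letter \<open>r\<close> use arbitrary subsets of
  \<open>R\<close>, so the induction hypothesis has to cover all of them.\<close>

lemma finite_min_induct [consumes 1, case_names empty insert]:
  fixes Y :: "nat set"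
  assumes "finite Y" and "P {}"
    and step: "\<And>r R. finite R \<Longrightarrow> (\<And>x. x \<in> R \<Longrightarrow> r < x) \<Longrightarrow> (\<And>A. A \<subseteq> R \<Longrightarrow> P A) \<Longrightarrow>
           P (insert r R)"
  shows "P Y"
  using \<open>finite Y\<close>
proof (induction rule: finite_psubset_induct)
  case (psubset Y)
  show ?case
  proof (cases "Y = {}")
    case False
    define r where "r = Min Y"
    define R where "R = Y - {r}"
    have "r \<in> Y" unfolding r_def using psubset.hyps False by simp
    then have Y: "Y = insert r R" "R \<subset> Y" unfolding R_def by auto
    have less: "r < x" if "x \<in> R" for x
    proof -
      have "x \<in> Y" "x \<noteq> r" using that unfolding R_def by auto
      moreover have "r \<le> x" unfolding r_def using psubset.hyps \<open>x \<in> Y\<close> by simp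
      ultimately show ?thesis by simp
    qed
    have IH: "P A" if "A \<subseteq> R" for A using that Y(2) psubset.IH by blast
    have "finite R" using psubset.hyps unfolding R_def by simp
    then have "P (insert r R)" using less IH by (rule step)
    then show ?thesis using Y(1) by simp
  qed (use assms in simp)
qed

lemma Max_insert_less:
  fixes r :: nat
  assumes "finite R" "R \<noteq> {}" "\<And>x. x \<in> R \<Longrightarrow> r < x"
  shows "Max (insert r R) = Max R"
  using assms Max_in[of R] by (simp add: max_absorb2 less_imp_le)

lemma Max_Diff_eq:
  fixes R :: "nat set"
  assumes "finite R" "R \<noteq> {}" "Max R \<notin> A"
  shows "Max (R - A) = Max R"
  using assms by (intro Max_eqI) auto

lemma Max_subset_eq:
  fixes R :: "nat set"
  assumes "finite R" "Max R \<in> A" "A \<subseteq> R"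
  shows "Max A = Max R"
  using assms by (intro Max_eqI) (auto intro: finite_subset)

lemma par_count_singleton [simp]: "par_count sel s {x} K = (if s \<in> K then 1 else 0)"
proof -
  have "{w \<in> {[x]}. nbr s x w \<in> K} = (if s \<in> K then {[x]} else {})" by auto
  then show ?thesis by (simp add: par_count_def)
qed

lemma par_count_empty_UNIV [simp]: "par_count sel s {} UNIV = 1"
  by (simp add: par_count_def)

lemma first_count_singleton [simp]: "first_count s {x} m K = (if m = x \<and> s \<in> K then 1 else 0)"
proof -
  have "{w \<in> {[x]}. w \<noteq> [] \<and> hd w = m \<and> nbr s x w \<in> K} = (if m = x \<and> s \<in> K then {[x]} else {})"
    by auto
  then show ?thesis by (simp add: first_count_def)
qed

lemma last_count_singleton [simp]: "last_count s {x} m K = (if m = x \<and> s \<in> K then 1 else 0)"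
proof -
  have "{w \<in> {[x]}. w \<noteq> [] \<and> last w = m \<and> nbr s x w \<in> K} = (if m = x \<and> s \<in> K then {[x]} else {})"
    by auto
  then show ?thesis by (simp add: last_count_def)
qed

lemma first_count_notin: "m \<notin> Y \<Longrightarrow> first_count s Y m K = 0"
  unfolding first_count_def andre_words_def by (auto simp: card_eq_0_iff)

lemma last_count_notin: "m \<notin> Y \<Longrightarrow> last_count s Y m K = 0"
  unfolding last_count_def andre_words_def by (auto simp: card_eq_0_iff)

lemma par_count_zero:
  assumes "finite Y" "Y \<noteq> {}" "K \<inter> insert s (Y - {Max Y}) = {}"
  shows "par_count sel s Y K = 0"
proof -
  have "nbr s (Max Y) w \<notin> K" if "w \<in> andre_words sel Y" for w
  proof -
    have "distinct w" "set w = Y" using that by (auto simp: andre_words_def)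
    then show ?thesis using nbr_mem[of w "Max Y" s] assms by auto
  qed
  then have "{w \<in> andre_words sel Y. nbr s (Max Y) w \<in> K} = {}" by blast
  then show ?thesis unfolding par_count_def by simp
qed

lemma par_count_UNIV: "par_count sel s Y UNIV = card (andre_words sel Y)"
  by (simp add: par_count_def)

lemma last_count_UNIV: "last_count s Y m UNIV = last_count 0 Y m UNIV"
  by (simp add: last_count_def)

lemma nbr_join_words:
  assumes "finite R" "R \<noteq> {}" "\<And>x. x \<in> R \<Longrightarrow> r < x" "s \<le> r" "A \<subseteq> R"
    and v: "v \<in> andre_words sel A" and v': "v' \<in> andre_words sel (R - A)"
  shows "nbr s (Max (insert r R)) (v @ r # v') =
    (if Max R \<in> A then nbr r (Max A) v else nbr r (Max (R - A)) v')"
proof -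
  have sets: "set v = A" "set v' = R - A" "distinct v" "distinct v'"
    using v v' by (auto simp: andre_words_def)
  have "nbr s (Max R) (v @ r # v') = (if Max R \<in> set v then nbr r (Max R) v else nbr r (Max R) v')"
    using assms(1-5) sets Max_in[OF assms(1,2)] by (intro nbr_join) auto
  then show ?thesis
    using Max_insert_less[OF assms(1-3)] Max_Diff_eq[OF assms(1,2), of A]
      Max_subset_eq[OF assms(1) _ \<open>A \<subseteq> R\<close>] sets(1) by auto
qed

text \<open>The greatest letter always goes to the right block, which thus carries the parent
  condition with \<open>r\<close> as new default; the left block is unrestricted.\<close>

lemma par_count_rec_I:
  assumes "finite R" "R \<noteq> {}" "\<And>x. x \<in> R \<Longrightarrow> r < x" "s \<le> r"
  shows "par_count Max s (insert r R) K =
    (\<Sum>A\<in>Pow (R - {Max R}). par_count Max 0 A UNIV * par_count Max r (R - A) K)"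
  unfolding par_count_def
proof (rule card_andre_words_split)
  fix A v v'
  assume "A \<subseteq> R - {Max R}" "v \<in> andre_words Max A" "v' \<in> andre_words Max (R - A)"
  moreover from this have "A \<subseteq> R" "Max R \<notin> A" by auto
  ultimately show "(nbr s (Max (insert r R)) (v @ r # v') \<in> K) \<longleftrightarrow>
     nbr 0 (Max A) v \<in> UNIV \<and> nbr r (Max (R - A)) v' \<in> K"
    using nbr_join_words[OF assms] by auto
qed (use assms in auto)

text \<open>Both sums run over the unordered splittings of \<open>R\<close> into two blocks: one
  names the block that avoids \<open>x\<close>, the other the block that avoids
  \<open>y\<close>.\<close>

lemma sum_Pow_complement:
  assumes "x \<in> R" "y \<in> R" and sym: "\<And>A. A \<subseteq> R \<Longrightarrow> f (R - A) = f A"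
  shows "(\<Sum>A\<in>Pow (R - {x}). f A) = (\<Sum>A\<in>Pow (R - {y}). f A)"
proof (rule sum.reindex_bij_witness[of _ "\<lambda>A. if x \<in> A then R - A else A"
        "\<lambda>A. if y \<in> A then R - A else A"])
  fix A assume "A \<in> Pow (R - {x})"
  then have A: "A \<subseteq> R" "x \<notin> A" by auto
  then have "R - (R - A) = A" by blast
  then show "(if x \<in> (if y \<in> A then R - A else A) then R - (if y \<in> A then R - A else A)
      else (if y \<in> A then R - A else A)) = A"
    using A assms(1,2) by auto
  show "(if y \<in> A then R - A else A) \<in> Pow (R - {y})" using A by auto
  show "f (if y \<in> A then R - A else A) = f A" using A sym by simp
next
  fix A assume "A \<in> Pow (R - {y})"
  then have A: "A \<subseteq> R" "y \<notin> A" by auto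
  then have "R - (R - A) = A" by blast
  then show "(if y \<in> (if x \<in> A then R - A else A) then R - (if x \<in> A then R - A else A)
      else (if x \<in> A then R - A else A)) = A"
    using A assms(1,2) by auto
  show "(if x \<in> A then R - A else A) \<in> Pow (R - {x})" using A by auto
qed

text \<open>Splitting gives a sum over blocks avoiding \<open>Min R\<close>. The summand
  \<open>f\<close> attaches the parent condition to whichever block contains \<open>Max R\<close>,
  hence is invariant under complement, and the named block may be taken to avoid
  \<open>Max R\<close> instead.\<close>

lemma par_count_rec_II:
  assumes "finite R" "R \<noteq> {}" "\<And>x. x \<in> R \<Longrightarrow> r < x" "s \<le> r"
  shows "par_count Min s (insert r R) K =
    (\<Sum>A\<in>Pow (R - {Max R}). par_count Min 0 A UNIV * par_count Min r (R - A) K)"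
proof -
  define f where "f A = (if Max R \<in> A then par_count Min r A K * par_count Min 0 (R - A) UNIV
      else par_count Min 0 A UNIV * par_count Min r (R - A) K)" for A
  have "par_count Min s (insert r R) K =
    (\<Sum>A\<in>Pow (R - {Min R}). card {v \<in> andre_words Min A. Max R \<in> A \<longrightarrow> nbr r (Max A) v \<in> K} *
       card {v' \<in> andre_words Min (R - A). Max R \<notin> A \<longrightarrow> nbr r (Max (R - A)) v' \<in> K})"
    unfolding par_count_def
  proof (rule card_andre_words_split)
    fix A v v'
    assume "A \<subseteq> R - {Min R}" "v \<in> andre_words Min A" "v' \<in> andre_words Min (R - A)"
    moreover from this have "A \<subseteq> R" by auto
    ultimately show "(nbr s (Max (insert r R)) (v @ r # v') \<in> K) \<longleftrightarrow>
     (Max R \<in> A \<longrightarrow> nbr r (Max A) v \<in> K) \<and> (Max R \<notin> A \<longrightarrow> nbr r (Max (R - A)) v' \<in> K)"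
      using nbr_join_words[OF assms] by auto
  qed (use assms in auto)
  also have "\<dots> = (\<Sum>A\<in>Pow (R - {Min R}). f A)"
    by (rule sum.cong) (auto simp: f_def par_count_def)
  also have "\<dots> = (\<Sum>A\<in>Pow (R - {Max R}). f A)"
    by (rule sum_Pow_complement) (use assms in \<open>auto simp: f_def double_diff\<close>)
  also have "\<dots> = (\<Sum>A\<in>Pow (R - {Max R}). par_count Min 0 A UNIV * par_count Min r (R - A) K)"
    by (rule sum.cong) (auto simp: f_def)
  finally show ?thesis .
qed

text \<open>Both sides obey the same recurrence. The tree correspondence between the two kinds of
  words enters the proof only through this equality of counts.\<close>

lemma par_count_Min_eq_Max:
  assumes "finite Y" "\<And>x. x \<in> Y \<Longrightarrow> s \<le> x"
  shows "par_count Min s Y K = par_count Max s Y K"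
  using assms
proof (induction arbitrary: s K rule: finite_min_induct)
  case empty
  then show ?case by (simp add: par_count_def)
next
  case (insert r R)
  show ?case
  proof (cases "R = {}")
    case False
    have s: "s \<le> r" using insert.prems by simp
    have "par_count Min 0 A UNIV * par_count Min r (R - A) K =
          par_count Max 0 A UNIV * par_count Max r (R - A) K" if "A \<subseteq> R" for A
    proof -
      have "r \<le> x" if "x \<in> R - A" for x using insert.hyps(2)[of x] that by simp
      then show ?thesis using insert.IH[of A 0 UNIV] insert.IH[of "R - A" r K] that by auto
    qed
    then have "(\<Sum>A\<in>Pow (R - {Max R}). par_count Min 0 A UNIV * par_count Min r (R - A) K) =
       (\<Sum>A\<in>Pow (R - {Max R}). par_count Max 0 A UNIV * par_count Max r (R - A) K)"
      by (intro sum.cong) auto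
    then show ?thesis
      using par_count_rec_I[OF insert.hyps(1) False insert.hyps(2) s, of K]
        par_count_rec_II[OF insert.hyps(1) False insert.hyps(2) s, of K]
      by simp
  qed simp
qed

text \<open>Taking \<open>K = UNIV\<close> drops the condition on the parent, so the default \<open>0\<close> is immaterial.\<close>

abbreviation "pc \<equiv> par_count Max"
abbreviation "num Y \<equiv> par_count Max 0 Y UNIV"
abbreviation "fc Y m \<equiv> first_count 0 Y m UNIV"
abbreviation "lc Y m \<equiv> last_count 0 Y m UNIV"

text \<open>The root comes first only if the left block is empty; then all of \<open>R\<close> hangs
  below \<open>r\<close>.\<close>

lemma first_count_min:
  assumes "finite R" "R \<noteq> {}" "\<And>x. x \<in> R \<Longrightarrow> r < x" "s \<le> r"
  shows "first_count s (insert r R) r K = pc r R K"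
proof -
  have "first_count s (insert r R) r K =
    (\<Sum>A\<in>Pow (R - {Max R}). card {v \<in> andre_words Max A. v = []} *
       card {v' \<in> andre_words Max (R - A). nbr r (Max (R - A)) v' \<in> K})"
    unfolding first_count_def
  proof (rule card_andre_words_split)
    fix A v v'
    assume A: "A \<subseteq> R - {Max R}" and v: "v \<in> andre_words Max A" "v' \<in> andre_words Max (R - A)"
    then have A': "A \<subseteq> R" "Max R \<notin> A" by auto
    have "hd (v @ r # v') = r \<longleftrightarrow> v = []"
    proof (cases v)
      case (Cons a u)
      then have "a \<in> R" using v(1) A' by (auto simp: andre_words_def)
      then show ?thesis using Cons assms(3)[of a] by simp
    qed simp
    then show "(v @ r # v' \<noteq> [] \<and> hd (v @ r # v') = r \<and> nbr s (Max (insert r R)) (v @ r # v') \<in> K)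
      \<longleftrightarrow> v = [] \<and> nbr r (Max (R - A)) v' \<in> K"
      using nbr_join_words[OF assms A'(1) v] A' by auto
  qed (use assms in auto)
  also have "\<dots> = (\<Sum>A\<in>Pow (R - {Max R}). if A = {} then pc r (R - A) K else 0)"
  proof (rule sum.cong)
    fix A
    have "{v \<in> andre_words Max A. v = []} = (if A = {} then {[]} else {})"
      by (auto simp: andre_words_def intro: andre_by.Nil)
    then show "card {v \<in> andre_words Max A. v = []} *
       card {v' \<in> andre_words Max (R - A). nbr r (Max (R - A)) v' \<in> K} =
       (if A = {} then pc r (R - A) K else 0)" by (simp add: par_count_def)
  qed simp
  also have "\<dots> = pc r R K" using assms(1) by (subst sum.delta) auto
  finally show ?thesis .
qed

lemma first_count_rec:
  assumes "finite R" "R \<noteq> {}" "\<And>x. x \<in> R \<Longrightarrow> r < x" "s \<le> r" "m \<noteq> r"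
  shows "first_count s (insert r R) m K = (\<Sum>A\<in>Pow (R - {Max R}). fc A m * pc r (R - A) K)"
  unfolding first_count_def par_count_def
proof (rule card_andre_words_split)
  fix A v v'
  assume A: "A \<subseteq> R - {Max R}" and v: "v \<in> andre_words Max A" "v' \<in> andre_words Max (R - A)"
  then have A': "A \<subseteq> R" "Max R \<notin> A" by auto
  show "(v @ r # v' \<noteq> [] \<and> hd (v @ r # v') = m \<and> nbr s (Max (insert r R)) (v @ r # v') \<in> K) \<longleftrightarrow>
    (v \<noteq> [] \<and> hd v = m \<and> nbr 0 (Max A) v \<in> UNIV) \<and> nbr r (Max (R - A)) v' \<in> K"
    using nbr_join_words[OF assms(1-4) A'(1) v] A' \<open>m \<noteq> r\<close> by (cases v) auto
qed (use assms in auto)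

text \<open>The last letter lies in the right block, the one with \<open>Min R\<close>, while the
  greatest letter can be in either block. The two branches record where the parent condition
  goes.\<close>

lemma last_count_rec:
  assumes "finite R" "R \<noteq> {}" "\<And>x. x \<in> R \<Longrightarrow> r < x" "s \<le> r"
  shows "last_count s (insert r R) m K = (\<Sum>A\<in>Pow (R - {Min R}).
    if Max R \<in> A then pc r A K * lc (R - A) m else num A * last_count r (R - A) m K)"
proof -
  have "last_count s (insert r R) m K =
    (\<Sum>A\<in>Pow (R - {Min R}). card {v \<in> andre_words Min A. Max R \<in> A \<longrightarrow> nbr r (Max A) v \<in> K} *
       card {v' \<in> andre_words Min (R - A). v' \<noteq> [] \<and> last v' = m \<and>
               (Max R \<notin> A \<longrightarrow> nbr r (Max (R - A)) v' \<in> K)})"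
    unfolding last_count_def
  proof (rule card_andre_words_split)
    fix A v v'
    assume A: "A \<subseteq> R - {Min R}" and v: "v \<in> andre_words Min A" "v' \<in> andre_words Min (R - A)"
    then have A': "A \<subseteq> R" by auto
    have "Min R \<in> R - A" using A assms by auto
    then have "v' \<noteq> []" using v(2) by (auto simp: andre_words_def)
    then show "(v @ r # v' \<noteq> [] \<and> last (v @ r # v') = m \<and> nbr s (Max (insert r R)) (v @ r # v') \<in> K)
      \<longleftrightarrow> (Max R \<in> A \<longrightarrow> nbr r (Max A) v \<in> K) \<and> v' \<noteq> [] \<and> last v' = m \<and>
               (Max R \<notin> A \<longrightarrow> nbr r (Max (R - A)) v' \<in> K)"
      using nbr_join_words[OF assms A' v] by auto
  qed (use assms in auto)
  also have "\<dots> = (\<Sum>A\<in>Pow (R - {Min R}).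
    if Max R \<in> A then par_count Min r A K * lc (R - A) m
    else par_count Min 0 A UNIV * last_count r (R - A) m K)"
    by (rule sum.cong) (auto simp: par_count_def last_count_def)
  also have "\<dots> = (\<Sum>A\<in>Pow (R - {Min R}).
    if Max R \<in> A then pc r A K * lc (R - A) m else num A * last_count r (R - A) m K)"
  proof (rule sum.cong)
    fix A assume "A \<in> Pow (R - {Min R})"
    then have A: "A \<subseteq> R" by auto
    then have "finite A" "\<And>x. x \<in> A \<Longrightarrow> r \<le> x"
      using assms(1,3) by (auto intro: finite_subset less_imp_le)
    then show "(if Max R \<in> A then par_count Min r A K * lc (R - A) m
        else par_count Min 0 A UNIV * last_count r (R - A) m K) =
      (if Max R \<in> A then pc r A K * lc (R - A) m else num A * last_count r (R - A) m K)"
      by (simp add: par_count_Min_eq_Max)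
  qed simp
  finally show ?thesis .
qed

subsection \<open>Rotation\<close>

lemma sum_Pow_insert:
  assumes "finite S" "x \<notin> S"
  shows "(\<Sum>A\<in>Pow (insert x S). f A) = (\<Sum>A\<in>Pow S. f A + f (insert x A))"
proof -
  have "inj_on (insert x) (Pow S)" using assms(2) by (auto simp: inj_on_def)
  then have "(\<Sum>A\<in>insert x ` Pow S. f A) = (\<Sum>A\<in>Pow S. f (insert x A))"
    by (simp add: sum.reindex)
  moreover have "Pow S \<inter> insert x ` Pow S = {}" using assms(2) by auto
  ultimately show ?thesis
    using assms(1) by (simp add: Pow_insert sum.union_disjoint sum.distrib)
qed

lemma sum_Pow_Diff: "(\<Sum>A\<in>Pow S. f (S - A)) = (\<Sum>A\<in>Pow S. f A)"
  by (rule sum.reindex_bij_witness[of _ "\<lambda>A. S - A" "\<lambda>A. S - A"]) (auto simp: double_diff)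

lemma sum_Pow_swap:
  assumes "finite S"
  shows "(\<Sum>A\<in>Pow S. \<Sum>C\<in>Pow (S - A). f A C) = (\<Sum>C\<in>Pow S. \<Sum>A\<in>Pow (S - C). f A C)"
proof -
  have "(\<Sum>A\<in>Pow S. \<Sum>C\<in>{C. C \<in> Pow S \<and> A \<inter> C = {}}. f A C) =
        (\<Sum>C\<in>Pow S. \<Sum>A\<in>{A. A \<in> Pow S \<and> A \<inter> C = {}}. f A C)"
    using assms by (intro sum.swap_restrict) auto
  moreover have "{C. C \<in> Pow S \<and> A \<inter> C = {}} = Pow (S - A)" for A by auto
  moreover have "{A. A \<in> Pow S \<and> A \<inter> C = {}} = Pow (S - C)" for C by auto
  ultimately show ?thesis by simp
qed

lemma card_eq_sum_card_fibres:
  assumes "finite X" "finite S" "\<And>w. w \<in> X \<Longrightarrow> g w \<in> S"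
  shows "card X = (\<Sum>k\<in>S. card {w \<in> X. g w = k})"
proof -
  have "X = (\<Union>k\<in>S. {w \<in> X. g w = k})" using assms(3) by auto
  also have "card \<dots> = (\<Sum>k\<in>S. card {w \<in> X. g w = k})"
    using assms(1,2) by (intro card_UN_disjoint) auto
  finally show ?thesis .
qed

lemma sum_first_count:
  assumes "finite Y" "Y \<noteq> {}"
  shows "(\<Sum>m\<in>Y. first_count s Y m K) = pc s Y K"
proof -
  have "pc s Y K = (\<Sum>m\<in>Y. card {w \<in> {w \<in> andre_words Max Y. nbr s (Max Y) w \<in> K}. hd w = m})"
    unfolding par_count_def
  proof (rule card_eq_sum_card_fibres)
    fix w assume "w \<in> {w \<in> andre_words Max Y. nbr s (Max Y) w \<in> K}"
    then have "set w = Y" "w \<noteq> []" using assms(2) by (auto simp: andre_words_def)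
    then show "hd w \<in> Y" by auto
  qed (use assms(1) in simp_all)
  moreover have "{w \<in> {w \<in> andre_words Max Y. nbr s (Max Y) w \<in> K}. hd w = m} =
     {w \<in> andre_words Max Y. w \<noteq> [] \<and> hd w = m \<and> nbr s (Max Y) w \<in> K}" for m
    using assms(2) by (auto simp: andre_words_def)
  ultimately show ?thesis by (simp add: first_count_def)
qed

lemma sum_last_count:
  assumes "finite Y" "Y \<noteq> {}" "\<And>x. x \<in> Y \<Longrightarrow> s \<le> x"
  shows "(\<Sum>m\<in>Y. last_count s Y m K) = pc s Y K"
proof -
  have "par_count Min s Y K =
      (\<Sum>m\<in>Y. card {w \<in> {w \<in> andre_words Min Y. nbr s (Max Y) w \<in> K}. last w = m})"
    unfolding par_count_def
  proof (rule card_eq_sum_card_fibres)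
    fix w assume "w \<in> {w \<in> andre_words Min Y. nbr s (Max Y) w \<in> K}"
    then have "set w = Y" "w \<noteq> []" using assms(2) by (auto simp: andre_words_def)
    then show "last w \<in> Y" by auto
  qed (use assms(1) in simp_all)
  moreover have "{w \<in> {w \<in> andre_words Min Y. nbr s (Max Y) w \<in> K}. last w = m} =
     {w \<in> andre_words Min Y. w \<noteq> [] \<and> last w = m \<and> nbr s (Max Y) w \<in> K}" for m
    using assms(2) by (auto simp: andre_words_def)
  ultimately show ?thesis using assms par_count_Min_eq_Max[of Y s K] by (simp add: last_count_def)
qed

lemma par_count_UNIV_default: "pc s Y UNIV = num Y"
  by (simp add: par_count_UNIV)

lemma Min_insert_less:
  fixes r :: nat
  assumes "finite R" "\<And>x. x \<in> R \<Longrightarrow> r < x"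
  shows "Min (insert r R) = r"
  using assms by (intro Min_eqI) (auto intro: less_imp_le)

text \<open>Without a parent condition the two branches of \<open>last_count_rec\<close>
  coincide.\<close>

lemma lc_rec:
  assumes "finite Q" "\<And>x. x \<in> Q \<Longrightarrow> q < x" "r < q"
  shows "lc (insert r (insert q Q)) m = (\<Sum>A\<in>Pow Q. num A * lc (insert q (Q - A)) m)"
proof -
  have q: "q \<notin> Q" using assms(2) by blast
  have r: "r < x" if "x \<in> insert q Q" for x using that assms(2)[of x] \<open>r < q\<close> by auto
  have Min: "Min (insert q Q) = q" using assms by (simp add: Min_insert_less)
  have "lc (insert r (insert q Q)) m = (\<Sum>A\<in>Pow Q. num A * lc (insert q Q - A) m)"
    using assms(1) r q Min last_count_rec[of "insert q Q" r 0 m UNIV]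
    by (simp add: par_count_UNIV_default[of r] last_count_UNIV[of r] cong: if_cong)
  also have "\<dots> = (\<Sum>A\<in>Pow Q. num A * lc (insert q (Q - A)) m)"
    using q by (intro sum.cong refl) (auto simp: insert_Diff_if)
  finally show ?thesis .
qed

text \<open>On trees: let \<open>r = p\<^sub>0 < p\<^sub>1 < \<dots>\<close> be the path of smallest children, which ends in \<open>m\<close>, let
  \<open>U\<^sub>j\<close> be the other subtree at \<open>p\<^sub>j\<close>, and let \<open>U\<^sub>i\<close> contain the greatest letter. Moving \<open>U\<^sub>j\<close> from
  \<open>p\<^sub>j\<close> to \<open>p\<^sub>j\<^sub>+\<^sub>1\<close> for \<open>j < i\<close> and cutting below \<open>p\<^sub>i\<close> leaves the subtree at \<open>p\<^sub>i\<^sub>+\<^sub>1\<close>, on the letters \<open>A\<close>,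
  and a tree on the remaining letters other than \<open>r\<close>.\<close>

lemma last_count_rotate:
  assumes "finite R" "R \<noteq> {}" "\<And>x. x \<in> R \<Longrightarrow> r < x" "s \<le> r" "m \<noteq> Max R"
  shows "last_count s (insert r R) m K = (\<Sum>A\<in>Pow (R - {Max R}). lc A m * pc r (R - A) K)"
  using assms
proof (induction arbitrary: r s rule: finite_min_induct)
  case empty
  then show ?case by simp
next
  case (insert q Q)
  note less_Q = insert.hyps(2) and fin = insert.hyps(1)
  have rq: "r < q" using insert.prems by simp
  have q: "q \<notin> Q" using less_Q by blast
  have Min: "Min (insert q Q) = q" using fin less_Q by (rule Min_insert_less)
  show ?case
  proof (cases "Q = {}")
    case True
    then show ?thesis using insert.prems last_count_rec[of "{q}" r s m K]
      by (simp add: last_count_notin)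
  next
    case False
    define N where "N = Max Q"
    define S where "S = Q - {N}"
    have N: "N \<in> Q" "Max (insert q Q) = N" "N \<noteq> q"
      using Max_in[OF fin False] q Max_insert_less[OF fin False less_Q] unfolding N_def by auto
    have S: "Q = insert N S" "N \<notin> S" "q \<notin> S" "finite S"
      using N q fin unfolding S_def by auto
    have A_Q: "insert q Q - A = insert q (Q - A)" "Q - A = insert N (S - A)" if "A \<in> Pow S" for A
      using that S(1,2,3) q by blast+
    have "last_count s (insert r (insert q Q)) m K =
      (\<Sum>A\<in>Pow Q. if N \<in> A then pc r A K * lc (insert q Q - A) m
                   else num A * last_count r (insert q Q - A) m K)"
      using last_count_rec[of "insert q Q" r s m K] fin q insert.prems(2,3) unfolding Min N(2)
      by simp
    also have "\<dots> = (\<Sum>A\<in>Pow S. num A * last_count r (insert q (Q - A)) m K) +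
                     (\<Sum>A\<in>Pow S. pc r (insert N A) K * lc (insert q Q - insert N A) m)"
    proof -
      have "(\<Sum>A\<in>Pow Q. f A) = (\<Sum>A\<in>Pow S. f A) + (\<Sum>A\<in>Pow S. f (insert N A))"
        for f :: "nat set \<Rightarrow> nat"
        unfolding S(1) sum_Pow_insert[OF S(4,2)] sum.distrib ..
      moreover have "N \<notin> A" if "A \<in> Pow S" for A using that S(2) by blast
      ultimately show ?thesis using A_Q(1) by simp
    qed
    \<comment> \<open>Complementing in \<open>S\<close> renames the summation set to the letters of
      the last-letter factor. With \<open>q\<close> added, these are the terms of the target sum
      whose block contains \<open>q\<close>.\<close>
    also have "(\<Sum>A\<in>Pow S. pc r (insert N A) K * lc (insert q Q - insert N A) m) =
               (\<Sum>A\<in>Pow S. pc r (insert N (S - A)) K * lc (insert q Q - insert N (S - A)) m)"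
      by (rule sum_Pow_Diff[symmetric])
    also have "\<dots> = (\<Sum>A\<in>Pow S. lc (insert q A) m * pc r (Q - A) K)"
    proof (rule sum.cong)
      fix A assume A: "A \<in> Pow S"
      have "insert q Q - insert N (S - A) = insert q A" using A S(1-3) N(3) by blast
      then show "pc r (insert N (S - A)) K * lc (insert q Q - insert N (S - A)) m =
                 lc (insert q A) m * pc r (Q - A) K"
        using A_Q[OF A] by simp
    qed simp
    \<comment> \<open>These become the terms whose block avoids \<open>q\<close>: the induction
      hypothesis at the root \<open>q\<close> splits off a block \<open>C\<close>, and after
      exchanging the two sums the inner one is \<open>par_count_rec_I\<close> at \<open>q\<close>,
      read backwards.\<close>
    also have "(\<Sum>A\<in>Pow S. num A * last_count r (insert q (Q - A)) m K) =
               (\<Sum>A\<in>Pow S. lc A m * pc r (insert q (Q - A)) K)"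
    proof -
      have Max: "Max (Q - A) = N" "Q - A \<noteq> {}" "Q - A - {N} = S - A" "finite (Q - A)"
        if "A \<in> Pow S" for A
      proof -
        have NA: "N \<notin> A" using that S(2) by blast
        then show "Max (Q - A) = N" using Max_Diff_eq[OF fin False, of A] unfolding N_def by simp
        show "Q - A \<noteq> {}" "Q - A - {N} = S - A" using NA N(1) unfolding S_def by blast+
        show "finite (Q - A)" using fin by simp
      qed
      have "(\<Sum>A\<in>Pow S. num A * last_count r (insert q (Q - A)) m K) =
            (\<Sum>A\<in>Pow S. \<Sum>C\<in>Pow (S - A). num A * (lc C m * pc q (Q - A - C) K))"
      proof (intro sum.cong refl)
        fix A assume A: "A \<in> Pow S"
        have "last_count r (insert q (Q - A)) m K =
              (\<Sum>C\<in>Pow (S - A). lc C m * pc q (Q - A - C) K)"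
          using insert.IH[of "Q - A" q r] Max[OF A] less_Q rq insert.prems(4) N(2) by simp
        then show "num A * last_count r (insert q (Q - A)) m K =
              (\<Sum>C\<in>Pow (S - A). num A * (lc C m * pc q (Q - A - C) K))"
          by (simp add: sum_distrib_left)
      qed
      also have "\<dots> = (\<Sum>C\<in>Pow S. \<Sum>A\<in>Pow (S - C). num A * (lc C m * pc q (Q - A - C) K))"
        by (rule sum_Pow_swap) (rule S)
      also have "\<dots> = (\<Sum>C\<in>Pow S. lc C m * (\<Sum>A\<in>Pow (S - C). num A * pc q (Q - C - A) K))"
      proof -
        have "Q - A - C = Q - C - A" for A C by blast
        then show ?thesis unfolding sum_distrib_left by (simp add: mult_ac)
      qed
      also have "\<dots> = (\<Sum>A\<in>Pow S. lc A m * pc r (insert q (Q - A)) K)"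
      proof (intro sum.cong refl)
        fix C assume C: "C \<in> Pow S"
        have "pc r (insert q (Q - C)) K = (\<Sum>A\<in>Pow (S - C). num A * pc q (Q - C - A) K)"
          using par_count_rec_I[of "Q - C" q r K] Max[OF C] less_Q rq by simp
        then show "lc C m * (\<Sum>A\<in>Pow (S - C). num A * pc q (Q - C - A) K) =
                   lc C m * pc r (insert q (Q - C)) K" by simp
      qed
      finally show ?thesis .
    qed
    also have "(\<Sum>A\<in>Pow S. lc A m * pc r (insert q (Q - A)) K) +
               (\<Sum>A\<in>Pow S. lc (insert q A) m * pc r (Q - A) K) =
       (\<Sum>A\<in>Pow (insert q S). lc A m * pc r (insert q Q - A) K)"
    proof -
      have "insert q Q - insert q A = Q - A" if "A \<in> Pow S" for A using that q by blast
      then show ?thesis unfolding sum_Pow_insert[OF S(4,3)] sum.distrib using A_Q(1) by simp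
    qed
    also have "insert q S = insert q Q - {Max (insert q Q)}"
      unfolding N(2) S_def using N(3) by blast
    finally show ?thesis .
  qed
qed

text \<open>The same rotation, applied to the path from the root to the leaf \<open>z\<close> below \<open>k\<close>.\<close>

lemma lc_eq_pc:
  assumes "finite R" "\<And>x. x \<in> R \<Longrightarrow> r < x" "\<And>x. x \<in> insert r R \<Longrightarrow> x < z"
  shows "lc (insert r R) k = pc r (insert z R) {k}"
  using assms
proof (induction arbitrary: r rule: finite_min_induct)
  case empty
  then show ?case by simp
next
  case (insert q Q)
  have rq: "r < q" and qz: "q < z" using insert.prems by auto
  have Max: "Max (insert z Q) = z"
    using insert.hyps(1) insert.prems(2) by (intro Max_eqI) (auto intro: less_imp_le)
  have z: "z \<notin> Q" using insert.prems(2) by blast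
  have "lc (insert r (insert q Q)) k = (\<Sum>A\<in>Pow Q. num A * lc (insert q (Q - A)) k)"
    using insert.hyps(1,2) rq by (rule lc_rec)
  also have "\<dots> = (\<Sum>A\<in>Pow Q. num A * pc q (insert z Q - A) {k})"
  proof (intro sum.cong refl)
    fix A assume A: "A \<in> Pow Q"
    then have "insert z Q - A = insert z (Q - A)" using z by auto
    then show "num A * lc (insert q (Q - A)) k = num A * pc q (insert z Q - A) {k}"
      using insert.IH[of "Q - A" q] insert.hyps(2) insert.prems(2) by auto
  qed
  also have "\<dots> = pc r (insert q (insert z Q)) {k}"
  proof -
    have "q < x" if "x \<in> insert z Q" for x using that insert.hyps(2) qz by blast
    moreover have "insert z Q - {z} = Q" using z by blast
    ultimately show ?thesis
      using par_count_rec_I[of "insert z Q" q r "{k}"] insert.hyps(1) rq unfolding Max by simp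
  qed
  finally show ?case by (simp add: insert_commute)
qed

text \<open>In an Andre I word the greatest letter stays to the right of the root, so it is missing
  from every possible left block.\<close>

lemma first_count_Max:
  assumes "finite R" "R \<noteq> {}" "\<And>x. x \<in> R \<Longrightarrow> r < x" "s \<le> r"
  shows "first_count s (insert r R) (Max R) K = 0"
proof -
  have "Max R \<noteq> r" using assms(3) Max_in[OF assms(1,2)] by blast
  moreover have "fc A (Max R) = 0" if "A \<in> Pow (R - {Max R})" for A
    using that by (intro first_count_notin) blast
  ultimately show ?thesis
    using first_count_rec[OF assms] by simp
qed

text \<open>The last letter ends the path of smallest children. If it is the greatest letter, it has
  no sibling, since a sibling would have to be greater; deleting it makes its parent
  \<open>k\<close> the new end of the path. The induction follows this path, and the terms with the
  greatest letter in the left block vanish.\<close>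

lemma last_count_Max:
  assumes "finite R" "R \<noteq> {}" "\<And>x. x \<in> R \<Longrightarrow> r < x" "s \<le> r"
  shows "last_count s (insert r R) (Max R) {k} = lc (insert r (R - {Max R})) k"
  using assms
proof (induction arbitrary: r s rule: finite_min_induct)
  case empty
  then show ?case by simp
next
  case (insert q Q)
  note less_Q = insert.hyps(2) and fin = insert.hyps(1)
  have rq: "r < q" using insert.prems by simp
  have q: "q \<notin> Q" using less_Q by blast
  have Min: "Min (insert q Q) = q" using fin less_Q by (rule Min_insert_less)
  show ?case
  proof (cases "Q = {}")
    case True
    then show ?thesis using insert.prems last_count_rec[of "{q}" r s q "{k}"] by simp
  next
    case False
    define N where "N = Max Q"
    define S where "S = Q - {N}"
    have N: "N \<in> Q" "Max (insert q Q) = N" "N \<noteq> q"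
      using Max_in[OF fin False] q Max_insert_less[OF fin False less_Q] unfolding N_def by auto
    have S: "Q = insert N S" "N \<notin> S" "q \<notin> S" "finite S"
      using N q fin unfolding S_def by auto
    have "last_count s (insert r (insert q Q)) N {k} =
      (\<Sum>A\<in>Pow Q. if N \<in> A then pc r A {k} * lc (insert q Q - A) N
                   else num A * last_count r (insert q Q - A) N {k})"
      using last_count_rec[of "insert q Q" r s N "{k}"] fin q insert.prems(2,3) unfolding Min N(2)
      by simp
    also have "\<dots> = (\<Sum>A\<in>Pow S. num A * last_count r (insert q Q - A) N {k})"
    proof -
      have "(\<Sum>A\<in>Pow Q. f A) = (\<Sum>A\<in>Pow S. f A) + (\<Sum>A\<in>Pow S. f (insert N A))"
        for f :: "nat set \<Rightarrow> nat"
        unfolding S(1) sum_Pow_insert[OF S(4,2)] sum.distrib ..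
      moreover have "N \<notin> A" if "A \<in> Pow S" for A using that S(2) by blast
      ultimately show ?thesis by (simp add: last_count_notin)
    qed
    also have "\<dots> = (\<Sum>A\<in>Pow S. num A * lc (insert q (S - A)) k)"
    proof (intro sum.cong refl)
      fix A assume A: "A \<in> Pow S"
      then have NA: "N \<notin> A" using S(2) by blast
      have "insert q Q - A = insert q (Q - A)" using A q S(3) by blast
      moreover have "Max (Q - A) = N"
        using NA Max_Diff_eq[OF fin False, of A] unfolding N_def by simp
      moreover have "Q - A \<noteq> {}" "Q - A - {N} = S - A" using NA N(1) unfolding S_def by blast+
      ultimately show "num A * last_count r (insert q Q - A) N {k} = num A * lc (insert q (S - A)) k"
        using insert.IH[of "Q - A" q r] less_Q rq by simp
    qed
    also have "\<dots> = lc (insert r (insert q S)) k"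
      using S(4) less_Q rq unfolding S_def by (subst lc_rec) auto
    also have "insert q S = insert q Q - {N}" using N(3) unfolding S_def by blast
    finally show ?thesis unfolding N(2) .
  qed
qed

text \<open>Classify the words by the parent \<open>k\<close> of \<open>y\<close>. By
  \<open>last_count_Max\<close> each class is counted by \<open>lc A k\<close>, and summing over
  \<open>k\<close> gives all words on \<open>A\<close>.\<close>

lemma lc_Max:
  assumes "finite A" "\<And>x. x \<in> A \<Longrightarrow> x < y"
  shows "lc (insert y A) y = num A"
proof (cases "A = {}")
  case False
  define r where "r = Min A"
  have r: "r \<in> A" "\<And>x. x \<in> A \<Longrightarrow> r \<le> x" using assms(1) False by (auto simp: r_def)
  define R where "R = insert y (A - {r})"
  have y: "y \<notin> A" using assms(2) by blast
  have R: "finite R" "R \<noteq> {}" "r < x" if "x \<in> R" for x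
    using assms(1) that r assms(2)[of r] by (auto simp: R_def le_neq_trans)
  have Max: "Max R = y" using assms by (intro Max_eqI) (auto simp: R_def less_imp_le)
  have Y: "insert y A = insert r R" "insert r (R - {y}) = A" using r y by (auto simp: R_def)
  have "lc (insert y A) y =
    card {w \<in> andre_words Min (insert y A). w \<noteq> [] \<and> last w = y}"
    by (simp add: last_count_def)
  also have "\<dots> = (\<Sum>k\<in>insert 0 (insert y A).
     card {w \<in> {w \<in> andre_words Min (insert y A). w \<noteq> [] \<and> last w = y}. nbr 0 (Max (insert y A)) w = k})"
  proof (rule card_eq_sum_card_fibres)
    fix w assume "w \<in> {w \<in> andre_words Min (insert y A). w \<noteq> [] \<and> last w = y}"
    then have "set w = insert y A" "distinct w" by (auto simp: andre_words_def)
    moreover have "Max (insert y A) \<in> insert y A" using assms(1) by (intro Max_in) auto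
    ultimately show "nbr 0 (Max (insert y A)) w \<in> insert 0 (insert y A)"
      using nbr_mem[of w "Max (insert y A)" 0] by blast
  qed (use assms(1) in auto)
  also have "\<dots> = (\<Sum>k\<in>insert 0 (insert y A). last_count 0 (insert y A) y {k})"
    unfolding last_count_def by (intro sum.cong refl arg_cong[of _ _ card]) auto
  also have "\<dots> = (\<Sum>k\<in>insert 0 (insert y A). lc A k)"
    using last_count_Max[of R r 0] R Y Max by (intro sum.cong refl) (auto simp: R_def)
  also have "\<dots> = (\<Sum>k\<in>A. lc A k)"
    by (rule sum.mono_neutral_right) (use assms(1) in \<open>auto simp: last_count_notin\<close>)
  also have "\<dots> = num A" using assms(1) False by (rule sum_last_count) simp
  finally show ?thesis .
qed simp

subsection \<open>Order isomorphisms\<close>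

lemma strict_mono_on_Max:
  fixes f :: "nat \<Rightarrow> nat"
  assumes "strict_mono_on S f" "finite S" "S \<noteq> {}"
  shows "Max (f ` S) = f (Max S)"
  using assms(2) Max_in[OF assms(2,3)] by (intro Max_eqI) (auto intro!: strict_mono_on_leD[OF assms(1)])

lemma strict_mono_on_Min:
  fixes f :: "nat \<Rightarrow> nat"
  assumes "strict_mono_on S f" "finite S" "S \<noteq> {}"
  shows "Min (f ` S) = f (Min S)"
  using assms(2) Min_in[OF assms(2,3)] by (intro Min_eqI) (auto intro!: strict_mono_on_leD[OF assms(1)])

lemma andre_by_map:
  assumes "andre_by sel w" "strict_mono_on (set w) f" "sel \<in> {Max, Min}"
  shows "andre_by sel (map f w)"
  using assms
proof (induction rule: andre_by.induct)
  case (split v x v')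
  have mono: "strict_mono_on (set v) f" "strict_mono_on (set v') f" "strict_mono_on (set (v @ v')) f"
    using split.prems(1) by (auto intro: monotone_on_subset)
  have ne: "set (v @ v') \<noteq> {}" using split.hyps(2) by simp
  have "andre_by sel (map f v @ f x # map f v')"
  proof (rule andre_by.split)
    show "distinct (map f v @ f x # map f v')"
      using split.hyps(1) strict_mono_on_imp_inj_on[OF split.prems(1)]
      by (metis distinct_map list.map(2) map_append)
    show "map f v @ map f v' \<noteq> []" using split.hyps(2) by simp
    have "Min (f ` set (v @ x # v')) = f (Min (set (v @ x # v')))"
      using split.prems(1) by (rule strict_mono_on_Min) auto
    then show "f x = Min (set (map f v @ f x # map f v'))"
      using split.hyps(3) by (simp add: image_Un)
    have "sel (f ` set (v @ v')) = f (sel (set (v @ v')))"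
      using strict_mono_on_Max[OF mono(3) _ ne] strict_mono_on_Min[OF mono(3) _ ne] split.prems(2)
      by auto
    then show "sel (set (map f v @ map f v')) \<in> set (map f v')"
      using split.hyps(6) by (simp add: image_Un)
  qed (use split.IH mono split.prems(2) in auto)
  then show ?case by simp
qed (auto intro: andre_by.intros)

lemma andre_words_image:
  assumes mono: "strict_mono_on Y f" and sel: "sel \<in> {Max, Min}"
  shows "andre_words sel (f ` Y) = map f ` andre_words sel Y"
proof (intro equalityI subsetI)
  fix w assume "w \<in> map f ` andre_words sel Y"
  then obtain u where u: "w = map f u" "set u = Y" "distinct u" "andre_by sel u"
    by (auto simp: andre_words_def)
  then show "w \<in> andre_words sel (f ` Y)"
    using andre_by_map[of sel u f] strict_mono_on_imp_inj_on[OF mono] mono sel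
    by (simp add: andre_words_def distinct_map)
next
  fix w assume w: "w \<in> andre_words sel (f ` Y)"
  have inj: "inj_on f Y" using mono by (rule strict_mono_on_imp_inj_on)
  define g where "g = the_inv_into Y f"
  have gf: "g (f y) = y" if "y \<in> Y" for y using that inj by (simp add: g_def the_inv_into_f_f)
  have g: "strict_mono_on (f ` Y) g"
  proof (rule strict_mono_onI)
    fix a b assume "a \<in> f ` Y" "b \<in> f ` Y" "a < b"
    then obtain x y where "a = f x" "b = f y" "x \<in> Y" "y \<in> Y" "f x < f y" by auto
    then show "g a < g b" using gf strict_mono_on_less[OF mono] by simp
  qed
  have "map f (map g w) = w"
    unfolding map_map using w gf by (intro map_idI) (auto simp: andre_words_def)
  moreover have "map g w \<in> andre_words sel Y"
  proof -
    have "g ` f ` Y = Y" using gf by force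
    then show ?thesis
      using w g andre_by_map[of sel w g] strict_mono_on_imp_inj_on[OF g] sel
      by (simp add: andre_words_def distinct_map)
  qed
  ultimately show "w \<in> map f ` andre_words sel Y" by (metis imageI)
qed

lemma card_andre_words_image:
  assumes mono: "strict_mono_on Y f" and sel: "sel \<in> {Max, Min}"
    and PQ: "\<And>w. w \<in> andre_words sel Y \<Longrightarrow> Q (map f w) \<longleftrightarrow> P w"
  shows "card {w \<in> andre_words sel (f ` Y). Q w} = card {w \<in> andre_words sel Y. P w}"
proof -
  have "{w \<in> andre_words sel (f ` Y). Q w} = map f ` {w \<in> andre_words sel Y. P w}"
    unfolding andre_words_image[OF mono sel] using PQ by auto
  moreover have "inj_on (map f) {w \<in> andre_words sel Y. P w}"
  proof (rule inj_on_mapI)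
    show "inj_on f (\<Union> (set ` {w \<in> andre_words sel Y. P w}))"
      using strict_mono_on_imp_inj_on[OF mono]
      by (rule inj_on_subset) (auto simp: andre_words_def)
  qed
  ultimately show ?thesis by (simp add: card_image)
qed

lemma nbr_map:
  assumes mono: "strict_mono_on (insert s (set w)) f" and "distinct w" "N \<in> set w"
  shows "nbr (f s) (f N) (map f w) = f (nbr s N w)"
proof -
  obtain p q where w: "w = p @ N # q" using assms(3) by (meson split_list)
  have inj: "inj_on f (insert s (set w))" using mono by (rule strict_mono_on_imp_inj_on)
  have N: "N \<notin> set p" using assms(2) w by auto
  then have fN: "f N \<notin> set (map f p)" using inj w by (auto simp: inj_on_def)
  have last: "last (f s # map f p) = f (last (s # p))" by (cases p) (auto simp: last_map)
  have hd: "hd (map f q @ [f s]) = f (hd (q @ [s]))" by (cases q) auto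
  have mem: "last (s # p) \<in> insert s (set w)" "hd (q @ [s]) \<in> insert s (set w)"
    using w by (auto simp: hd_append)
  have "max (f a) (f b) = f (max a b)" if "a \<in> insert s (set w)" "b \<in> insert s (set w)" for a b
    using strict_mono_on_leD[OF mono that] strict_mono_on_leD[OF mono that(2,1)]
    by (auto simp: max_def)
  then show ?thesis
    using nbr_append[OF fN, of "f s" "map f q"] nbr_append[OF N, of s q] mem
    unfolding w by (simp add: last hd del: last.simps)
qed

lemma nbr_map_words:
  assumes "finite Y" "Y \<noteq> {}" "strict_mono_on (insert s Y) f" "w \<in> andre_words sel Y"
  shows "nbr (f s) (Max (f ` Y)) (map f w) = f (nbr s (Max Y) w)"
    and "nbr s (Max Y) w \<in> insert s Y" and "w \<noteq> []" and "set w = Y"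
proof -
  have w: "distinct w" "set w = Y" using assms(4) by (auto simp: andre_words_def)
  then show "set w = Y" "w \<noteq> []" using assms(2) by auto
  have "strict_mono_on Y f" using assms(3) by (rule monotone_on_subset) auto
  then have "Max (f ` Y) = f (Max Y)" using assms(1,2) by (simp add: strict_mono_on_Max)
  then show "nbr (f s) (Max (f ` Y)) (map f w) = f (nbr s (Max Y) w)"
    using nbr_map[of s w f "Max Y"] w assms by simp
  show "nbr s (Max Y) w \<in> insert s Y"
    using nbr_mem[of w "Max Y" s] w assms(1,2) by auto
qed

context
  fixes f :: "nat \<Rightarrow> nat" and s :: nat and Y K K' :: "nat set"
  assumes Y: "finite Y" "Y \<noteq> {}" and mono: "strict_mono_on (insert s Y) f"
    and K: "\<And>k. k \<in> insert s Y \<Longrightarrow> f k \<in> K' \<longleftrightarrow> k \<in> K"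
begin

lemma strict_mono_on_carrier: "strict_mono_on Y f"
  using mono by (rule monotone_on_subset) auto

lemma par_count_image: "pc (f s) (f ` Y) K' = pc s Y K"
  unfolding par_count_def
proof (rule card_andre_words_image[OF strict_mono_on_carrier])
  fix w assume "w \<in> andre_words Max Y"
  note w = nbr_map_words[OF Y mono this]
  show "(nbr (f s) (Max (f ` Y)) (map f w) \<in> K') \<longleftrightarrow> (nbr s (Max Y) w \<in> K)"
    unfolding w(1) using w(2) by (rule K)
qed simp

lemma first_count_image:
  assumes "m \<in> Y"
  shows "first_count (f s) (f ` Y) (f m) K' = first_count s Y m K"
  unfolding first_count_def
proof (rule card_andre_words_image[OF strict_mono_on_carrier])
  fix w assume w: "w \<in> andre_words Max Y"
  have "hd w \<in> Y" using nbr_map_words(3,4)[OF Y mono w] hd_in_set by blast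
  then have "hd (map f w) = f m \<longleftrightarrow> hd w = m"
    using nbr_map_words(3)[OF Y mono w] inj_onD[OF strict_mono_on_imp_inj_on[OF strict_mono_on_carrier]] assms
    by (auto simp: hd_map)
  then show "(map f w \<noteq> [] \<and> hd (map f w) = f m \<and> nbr (f s) (Max (f ` Y)) (map f w) \<in> K') \<longleftrightarrow>
        (w \<noteq> [] \<and> hd w = m \<and> nbr s (Max Y) w \<in> K)"
    using nbr_map_words[OF Y mono w] K by simp
qed simp

lemma last_count_image:
  assumes "m \<in> Y"
  shows "last_count (f s) (f ` Y) (f m) K' = last_count s Y m K"
  unfolding last_count_def
proof (rule card_andre_words_image[OF strict_mono_on_carrier])
  fix w assume w: "w \<in> andre_words Min Y"
  have "last w \<in> Y" using nbr_map_words(3,4)[OF Y mono w] last_in_set by blast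
  then have "last (map f w) = f m \<longleftrightarrow> last w = m"
    using nbr_map_words(3)[OF Y mono w] inj_onD[OF strict_mono_on_imp_inj_on[OF strict_mono_on_carrier]] assms
    by (auto simp: last_map)
  then show "(map f w \<noteq> [] \<and> last (map f w) = f m \<and> nbr (f s) (Max (f ` Y)) (map f w) \<in> K') \<longleftrightarrow>
        (w \<noteq> [] \<and> last w = m \<and> nbr s (Max Y) w \<in> K)"
    using nbr_map_words[OF Y mono w] K by simp
qed simp

end

text \<open>With \<open>K = UNIV\<close> the default is arbitrary, so both sides keep
  \<open>0\<close> whatever \<open>f\<close> does to it.\<close>

lemma fc_image:
  assumes mono: "strict_mono_on Y f" and "m \<in> Y"
  shows "fc (f ` Y) (f m) = fc Y m"
  unfolding first_count_def
proof (rule card_andre_words_image[OF mono])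
  fix w assume "w \<in> andre_words Max Y"
  then have "w \<noteq> []" "set w = Y" using assms(2) by (auto simp: andre_words_def)
  then have "w \<noteq> []" "hd w \<in> Y" using hd_in_set by blast+
  then show "(map f w \<noteq> [] \<and> hd (map f w) = f m \<and> nbr 0 (Max (f ` Y)) (map f w) \<in> UNIV) \<longleftrightarrow>
        (w \<noteq> [] \<and> hd w = m \<and> nbr 0 (Max Y) w \<in> UNIV)"
    using inj_onD[OF strict_mono_on_imp_inj_on[OF mono]] assms(2) by (auto simp: hd_map)
qed simp

lemma lc_image:
  assumes mono: "strict_mono_on Y f" and "m \<in> Y"
  shows "lc (f ` Y) (f m) = lc Y m"
  unfolding last_count_def
proof (rule card_andre_words_image[OF mono])
  fix w assume "w \<in> andre_words Min Y"
  then have "w \<noteq> []" "set w = Y" using assms(2) by (auto simp: andre_words_def)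
  then have "w \<noteq> []" "last w \<in> Y" using last_in_set by blast+
  then show "(map f w \<noteq> [] \<and> last (map f w) = f m \<and> nbr 0 (Max (f ` Y)) (map f w) \<in> UNIV) \<longleftrightarrow>
        (w \<noteq> [] \<and> last w = m \<and> nbr 0 (Max Y) w \<in> UNIV)"
    using inj_onD[OF strict_mono_on_imp_inj_on[OF mono]] assms(2) by (auto simp: last_map)
qed simp

text \<open>\<open>x\<close> and \<open>y\<close> lie in the same gap of \<open>A\<close>, so
  renaming \<open>x\<close> to \<open>y\<close> respects the order. All replacement lemmas below are
  instances of this renaming.\<close>

lemma strict_mono_on_replace:
  fixes x y :: nat
  assumes "\<And>a. a \<in> A \<Longrightarrow> a < x \<and> a < y \<or> x < a \<and> y < a"
  shows "strict_mono_on (insert x A) (id(x := y))"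
  by (rule strict_mono_onI) (use assms in fastforce)

lemma replace_image:
  assumes "\<And>a. a \<in> A \<Longrightarrow> a < x \<and> a < y \<or> x < a \<and> y < (a :: nat)"
  shows "(id(x := y)) ` insert x A = insert y A"
  using assms by fastforce

lemma fc_replace:
  assumes "\<And>a. a \<in> A \<Longrightarrow> a < x \<and> a < y \<or> x < a \<and> y < a"
  shows "fc (insert x A) x = fc (insert y A) y"
  using fc_image[OF strict_mono_on_replace[OF assms], of A x] replace_image[OF assms, of A] by simp

lemma lc_replace:
  assumes "\<And>a. a \<in> A \<Longrightarrow> a < x \<and> a < y \<or> x < a \<and> y < a"
  shows "lc (insert x A) x = lc (insert y A) y"
  using lc_image[OF strict_mono_on_replace[OF assms], of A x] replace_image[OF assms, of A] by simp

lemma pc_replace: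
  assumes A: "\<And>a. a \<in> A \<Longrightarrow> a < x \<and> a < y \<or> x < a \<and> y < a" and "finite A"
    and s: "s < x" "s < y" and K: "x \<in> K \<longleftrightarrow> y \<in> K"
  shows "pc s (insert x A) K = pc s (insert y A) K"
proof -
  have "strict_mono_on (insert x (insert s A)) (id(x := y))"
    by (rule strict_mono_on_replace) (use assms in auto)
  then have "strict_mono_on (insert s (insert x A)) (id(x := y))"
    by (simp add: insert_commute)
  then have "pc ((id(x := y)) s) ((id(x := y)) ` insert x A) K = pc s (insert x A) K"
    using assms(2) K by (intro par_count_image[of "insert x A" s "id(x := y)" K K]) auto
  then show ?thesis using s replace_image[OF A, of A] by simp
qed

lemma pc_replace_default:
  assumes "finite Y" "Y \<noteq> {}" "\<And>a. a \<in> Y \<Longrightarrow> s < a \<and> t < a" "s \<in> K \<longleftrightarrow> t \<in> K"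
  shows "pc s Y K = pc t Y K"
proof -
  have "strict_mono_on (insert s Y) (id(s := t))"
    by (rule strict_mono_on_replace) (use assms in auto)
  then have "pc ((id(s := t)) s) ((id(s := t)) ` Y) K = pc s Y K"
    using assms by (intro par_count_image[of Y s "id(s := t)" K K]) auto
  moreover have "(id(s := t)) ` Y = Y" using assms(3) by force
  ultimately show ?thesis by simp
qed

subsection \<open>Exchanging consecutive letters\<close>

text \<open>In the rotated recurrence the last letter is sought in subsets of \<open>R\<close>, none
  of which contains the root \<open>r\<close>.\<close>

lemma last_count_min:
  assumes "finite R" "R \<noteq> {}" "\<And>x. x \<in> R \<Longrightarrow> r < x" "s \<le> r"
  shows "last_count s (insert r R) r K = 0"
proof -
  have r: "r \<notin> R" using assms(3) by blast
  then have "r \<noteq> Max R" using Max_in[OF assms(1,2)] by blast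
  moreover have "lc A r = 0" if "A \<in> Pow (R - {Max R})" for A
    using that r by (intro last_count_notin) blast
  ultimately show ?thesis using last_count_rotate[OF assms] by simp
qed

lemma sum_Pow_insert_vanishing:
  assumes "finite S" "x \<notin> S" "\<And>A. A \<subseteq> S \<Longrightarrow> p A = 0"
  shows "(\<Sum>A\<in>Pow (insert x S). p A * g A) = (\<Sum>A\<in>Pow S. p (insert x A) * (g (insert x A) :: nat))"
  unfolding sum_Pow_insert[OF assms(1,2)] using assms(3) by simp

text \<open>\<open>lc_eq_pc\<close> matches last letter \<open>k\<close> on one side with parent
  \<open>k\<close> on the other; summing over \<open>k\<close> removes both conditions.\<close>

lemma num_shift:
  assumes "finite R" "\<And>x. x \<in> R \<Longrightarrow> r < x" "\<And>x. x \<in> insert r R \<Longrightarrow> x < z"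
  shows "num (insert z R) = num (insert r R)"
proof -
  have "num (insert z R) = card (andre_words Max (insert z R))" by (rule par_count_UNIV)
  also have "\<dots> = (\<Sum>k\<in>insert z (insert r R).
      card {w \<in> andre_words Max (insert z R). nbr r (Max (insert z R)) w = k})"
  proof (rule card_eq_sum_card_fibres)
    fix w assume "w \<in> andre_words Max (insert z R)"
    then have "set w = insert z R" "distinct w" by (auto simp: andre_words_def)
    moreover have "Max (insert z R) \<in> insert z R" using assms(1) by (intro Max_in) auto
    ultimately show "nbr r (Max (insert z R)) w \<in> insert z (insert r R)"
      using nbr_mem[of w "Max (insert z R)" r] by blast
  qed (use assms(1) in auto)
  also have "\<dots> = (\<Sum>k\<in>insert z (insert r R). pc r (insert z R) {k})"
    by (simp add: par_count_def)
  also have "\<dots> = (\<Sum>k\<in>insert z (insert r R). lc (insert r R) k)"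
    using lc_eq_pc[OF assms] by simp
  also have "\<dots> = (\<Sum>k\<in>insert r R. lc (insert r R) k)"
    by (rule sum.mono_neutral_right) (use assms(1) in \<open>auto simp: last_count_notin\<close>)
  also have "\<dots> = num (insert r R)"
    using assms(1) by (intro sum_last_count) auto
  finally show ?thesis .
qed

text \<open>The left block contains \<open>p\<close> but not \<open>q\<close>, so \<open>p\<close>
  is its greatest letter. Being also its first letter, it must be alone there.\<close>

lemma first_count_second_max:
  assumes "finite T" "\<And>a. a \<in> T \<Longrightarrow> r < a \<and> a < p" "r < p" "p < q" "s \<le> r"
  shows "first_count s (insert r (insert q (insert p T))) p K = pc r (insert q T) K"
proof -
  let ?R = "insert q (insert p T)"
  have nin: "p \<notin> T" "q \<notin> T" using assms(2,4) by fastforce+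
  have Max: "Max ?R = q" using assms by (intro Max_eqI) (auto dest!: assms(2))
  have "first_count s (insert r ?R) p K = (\<Sum>A\<in>Pow (?R - {Max ?R}). fc A p * pc r (?R - A) K)"
    using assms by (intro first_count_rec) auto
  also have "?R - {Max ?R} = insert p T" unfolding Max using nin assms(4) by auto
  also have "(\<Sum>A\<in>Pow (insert p T). fc A p * pc r (?R - A) K) =
             (\<Sum>A\<in>Pow T. fc (insert p A) p * pc r (?R - insert p A) K)"
    using assms(1) nin by (intro sum_Pow_insert_vanishing) (auto intro: first_count_notin)
  also have "\<dots> = (\<Sum>A\<in>Pow T. if A = {} then pc r (insert q T) K else 0)"
  proof (intro sum.cong refl)
    fix A assume A: "A \<in> Pow T"
    show "fc (insert p A) p * pc r (?R - insert p A) K = (if A = {} then pc r (insert q T) K else 0)"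
    proof (cases "A = {}")
      case True
      have "?R - {p} = insert q T" using nin assms(4) by auto
      then show ?thesis using True by simp
    next
      case False
      have fA: "finite A" using A assms(1) by (auto intro: finite_subset)
      define u where "u = Min A"
      have u: "u \<in> A" "\<And>x. x \<in> A \<Longrightarrow> u \<le> x" using fA False by (auto simp: u_def)
      define B where "B = insert p (A - {u})"
      have B: "insert u B = insert p A" "Max B = p"
        using u fA A assms(2) by (auto simp: B_def intro!: Max_eqI dest: less_imp_le)
      have "fc (insert u B) (Max B) = 0"
        using u fA A assms(2) by (intro first_count_Max) (auto simp: B_def le_neq_trans)
      then show ?thesis using False B by simp
    qed
  qed
  also have "\<dots> = pc r (insert q T) K" using assms(1) by (subst sum.delta) auto
  finally show ?thesis .
qed

text \<open>In the rotated recurrence \<open>p\<close> is the greatest letter of its block, and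
  \<open>lc_Max\<close> deletes it. Renaming \<open>q\<close> to the freed letter \<open>p\<close>
  in the other block turns the sum into the parent recurrence on the set without
  \<open>q\<close>.\<close>

lemma last_count_second_max:
  assumes "finite T" "\<And>a. a \<in> T \<Longrightarrow> r < a \<and> a < p" "r < p" "p < q" "s \<le> r"
    and K: "p \<in> K \<longleftrightarrow> q \<in> K"
  shows "last_count s (insert r (insert q (insert p T))) p K = pc s (insert r (insert p T)) K"
proof -
  let ?R = "insert q (insert p T)"
  have nin: "p \<notin> T" "q \<notin> T" using assms(2,4) by fastforce+
  have Max: "Max ?R = q" using assms by (intro Max_eqI) (auto dest!: assms(2))
  have Max': "Max (insert p T) = p" using assms by (intro Max_eqI) (auto dest!: assms(2))
  have "last_count s (insert r ?R) p K = (\<Sum>A\<in>Pow (?R - {Max ?R}). lc A p * pc r (?R - A) K)"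
  proof (rule last_count_rotate)
    show "p \<noteq> Max ?R" unfolding Max using assms(4) by simp
  qed (use assms in auto)
  also have "?R - {Max ?R} = insert p T" unfolding Max using nin assms(4) by auto
  also have "(\<Sum>A\<in>Pow (insert p T). lc A p * pc r (?R - A) K) =
             (\<Sum>A\<in>Pow T. lc (insert p A) p * pc r (?R - insert p A) K)"
    using assms(1) nin by (intro sum_Pow_insert_vanishing) (auto intro: last_count_notin)
  also have "\<dots> = (\<Sum>A\<in>Pow T. num A * pc r (insert p T - A) K)"
  proof (intro sum.cong refl)
    fix A assume A: "A \<in> Pow T"
    have sets: "?R - insert p A = insert q (T - A)" "insert p T - A = insert p (T - A)"
      using A nin assms(4) by auto
    have "lc (insert p A) p = num A"
      using A assms(1,2) by (intro lc_Max) (auto intro: finite_subset)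
    moreover have "pc r (insert q (T - A)) K = pc r (insert p (T - A)) K"
      using assms by (intro pc_replace) (auto dest!: assms(2))
    ultimately show "lc (insert p A) p * pc r (?R - insert p A) K = num A * pc r (insert p T - A) K"
      unfolding sets by simp
  qed
  also have "\<dots> = pc s (insert r (insert p T)) K"
  proof -
    have "r < x" if "x \<in> insert p T" for x using that assms(2,3) by blast
    moreover have "insert p T - {p} = T" using nin by blast
    ultimately show ?thesis
      using par_count_rec_I[of "insert p T" r s K] assms(1,5) unfolding Max' by simp
  qed
  finally show ?thesis .
qed

text \<open>If \<open>y\<close> is first, the left block is rooted at \<open>y\<close> and
  contributes \<open>num A\<close>. The resulting sum is the parent recurrence for \<open>y\<close>
  as root of everything but \<open>x\<close>, which is also what remains when \<open>x\<close> is
  first.\<close>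

lemma first_count_diff_min:
  assumes "finite T" "T \<noteq> {}" "\<And>a. a \<in> T \<Longrightarrow> y < a" "x < y" "s \<le> x" and K: "x \<in> K \<longleftrightarrow> y \<in> K"
  shows "first_count s (insert x (insert y T)) x K = first_count s (insert x (insert y T)) y K"
proof -
  define N where "N = Max T"
  have N: "N \<in> T" using assms(1,2) by (simp add: N_def)
  have y: "y \<notin> T" using assms(3) by blast
  have Max: "Max (insert y T) = N" unfolding N_def using assms(1-3) by (rule Max_insert_less)
  have less: "x < a" if "a \<in> insert y T" for a using that assms(3)[of a] assms(4) by auto
  have "first_count s (insert x (insert y T)) y K =
     (\<Sum>A\<in>Pow (insert y T - {N}). fc A y * pc x (insert y T - A) K)"
    using assms(1,4,5) less first_count_rec[of "insert y T" x s y K] unfolding Max by auto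
  also have "insert y T - {N} = insert y (T - {N})" using N y by auto
  also have "(\<Sum>A\<in>Pow (insert y (T - {N})). fc A y * pc x (insert y T - A) K) =
     (\<Sum>A\<in>Pow (T - {N}). fc (insert y A) y * pc x (insert y T - insert y A) K)"
    using assms(1) y by (intro sum_Pow_insert_vanishing) (auto intro: first_count_notin)
  also have "\<dots> = (\<Sum>A\<in>Pow (T - {N}). num A * pc y (T - A) K)"
  proof (intro sum.cong refl)
    fix A assume A: "A \<in> Pow (T - {N})"
    have "insert y T - insert y A = T - A" using y by auto
    moreover have "fc (insert y A) y = num A"
    proof (cases "A = {}")
      case False
      then have "fc (insert y A) y = pc y A UNIV"
        using A assms(1,3) by (intro first_count_min) (auto intro: finite_subset)
      then show ?thesis by (simp add: par_count_UNIV)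
    qed simp
    moreover have "pc x (T - A) K = pc y (T - A) K"
      using A N assms less by (intro pc_replace_default) auto
    ultimately show "fc (insert y A) y * pc x (insert y T - insert y A) K = num A * pc y (T - A) K"
      by simp
  qed
  also have "\<dots> = pc x (insert y T) K"
    using par_count_rec_I[of T y x K] assms unfolding N_def by simp
  also have "\<dots> = first_count s (insert x (insert y T)) x K"
    using first_count_min[of "insert y T" x s K] assms(1,5) less by simp
  finally show ?thesis by simp
qed

text \<open>In the rotated recurrence \<open>y\<close> is the least letter of its block, so it can
  be last only in the block \<open>{y}\<close>. What remains is \<open>T\<close> hanging below
  \<open>x\<close>.\<close>

lemma last_count_diff_min:
  assumes "finite T" "T \<noteq> {}" "\<And>a. a \<in> T \<Longrightarrow> y < a" "x < y" "s \<le> x"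
  shows "last_count s (insert x (insert y T)) y K = first_count s (insert x T) x K"
proof -
  define N where "N = Max T"
  have N: "N \<in> T" using assms(1,2) by (simp add: N_def)
  have y: "y \<notin> T" using assms(3) by blast
  have Max: "Max (insert y T) = N" unfolding N_def using assms(1-3) by (rule Max_insert_less)
  have less: "x < a" if "a \<in> insert y T" for a using that assms(3)[of a] assms(4) by auto
  have "y \<noteq> N" using N y by blast
  then have "last_count s (insert x (insert y T)) y K =
     (\<Sum>A\<in>Pow (insert y T - {N}). lc A y * pc x (insert y T - A) K)"
    using assms(1,5) less last_count_rotate[of "insert y T" x s y K] unfolding Max by simp
  also have "insert y T - {N} = insert y (T - {N})" using N y by auto
  also have "(\<Sum>A\<in>Pow (insert y (T - {N})). lc A y * pc x (insert y T - A) K) =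
     (\<Sum>A\<in>Pow (T - {N}). lc (insert y A) y * pc x (insert y T - insert y A) K)"
    using assms(1) y by (intro sum_Pow_insert_vanishing) (auto intro: last_count_notin)
  also have "\<dots> = (\<Sum>A\<in>Pow (T - {N}). if A = {} then pc x T K else 0)"
  proof (intro sum.cong refl)
    fix A assume A: "A \<in> Pow (T - {N})"
    have "insert y T - insert y A = T - A" using y by auto
    moreover have "lc (insert y A) y = 0" if "A \<noteq> {}"
      using A assms(1,3) that by (intro last_count_min) (auto intro: finite_subset)
    ultimately show "lc (insert y A) y * pc x (insert y T - insert y A) K =
        (if A = {} then pc x T K else 0)" by simp
  qed
  also have "\<dots> = pc x T K" using assms(1) by (subst sum.delta) auto
  also have "\<dots> = first_count s (insert x T) x K"
    using assms less by (subst first_count_min) auto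
  finally show ?thesis .
qed

text \<open>The cancellation behind both difference relations: sets are grouped by their trace on
  \<open>{x, y}\<close>. The empty trace gives equal terms, the two singleton traces balance each
  other, and only sets containing both letters contribute, through the correction \<open>D\<close>
  on the set without \<open>y\<close>.\<close>

lemma sum_Pow_split_pair:
  fixes g P P' D :: "nat set \<Rightarrow> nat"
  assumes "finite S" "x \<notin> S" "y \<notin> S" "x \<noteq> y"
    and "\<And>A. A \<subseteq> S \<Longrightarrow> P A = P' A" and "\<And>A. A \<subseteq> S \<Longrightarrow> D A = 0"
    and "\<And>A. A \<subseteq> S \<Longrightarrow> P (insert x A) * g (insert x A) + P (insert y A) * g (insert y A) =
                        P' (insert x A) * g (insert x A) + P' (insert y A) * g (insert y A)"
    and "\<And>A. A \<subseteq> S \<Longrightarrow> P (insert x (insert y A)) = P' (insert x (insert y A)) + D (insert x A)"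
  shows "(\<Sum>A\<in>Pow (insert y (insert x S)). P A * g A) =
    (\<Sum>A\<in>Pow (insert y (insert x S)). P' A * g A) + (\<Sum>A\<in>Pow (insert x S). D A * g (insert y A))"
proof -
  have split: "(\<Sum>A\<in>Pow (insert y (insert x S)). f A) =
     (\<Sum>A\<in>Pow S. f A + (f (insert x A) + f (insert y A)) + f (insert x (insert y A)))"
    for f :: "nat set \<Rightarrow> nat"
    using assms(1-4)
    by (simp add: sum_Pow_insert sum.distrib insert_commute add_ac)
  have D: "(\<Sum>A\<in>Pow (insert x S). D A * g (insert y A)) =
     (\<Sum>A\<in>Pow S. D (insert x A) * g (insert x (insert y A)))"
    using assms(1,2,6) by (simp add: sum_Pow_insert_vanishing insert_commute)
  show ?thesis
    unfolding split D sum.distrib[symmetric] using assms(5,7,8)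
    by (intro sum.cong refl) (simp add: algebra_simps)
qed

context
  fixes S :: "nat set" and r x y N s :: nat and K :: "nat set"
  assumes S: "finite S" "\<And>a. a \<in> S \<Longrightarrow> r < a \<and> a < N \<and> (a < x \<or> y < a)"
    and ord: "s \<le> r" "r < x" "x < y" "y < N" and K: "x \<in> K \<longleftrightarrow> y \<in> K"
begin

lemma nin_S: "x \<notin> S" "y \<notin> S" "N \<notin> S"
  using S(2) ord by fastforce+

lemma Max_pair: "Max (insert N (insert y (insert x S))) = N" "Max (insert N (insert x S)) = N"
  using S ord by (auto intro!: Max_eqI dest!: S(2))

lemma Diff_pair:
  "insert N (insert y (insert x S)) - {N} = insert y (insert x S)"
  "insert N (insert x S) - {N} = insert x S"
  using nin_S ord by auto

text \<open>Each right block contains exactly one of the two letters. No letter of the rest lies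
  between them and \<open>K\<close> does not tell them apart, so one can be renamed to the
  other.\<close>

lemma pc_swap_pair:
  assumes "A \<subseteq> S"
  shows "pc r (insert N (insert y (insert x S)) - insert x A) K =
         pc r (insert N (insert y (insert x S)) - insert y A) K"
proof -
  have "insert N (insert y (insert x S)) - insert x A = insert y (insert N (S - A))"
       "insert N (insert y (insert x S)) - insert y A = insert x (insert N (S - A))"
    using assms nin_S ord by auto
  moreover have "pc r (insert x (insert N (S - A))) K = pc r (insert y (insert N (S - A))) K"
    using S ord K by (intro pc_replace) (auto dest!: S(2))
  ultimately show ?thesis by simp
qed

text \<open>Adding \<open>y\<close> to the whole set and to the left block leaves the right block
  unchanged; this aligns the correction terms with the recurrence on the set without
  \<open>y\<close>.\<close>

lemma Diff_insert_pair:
  assumes "A \<in> Pow (insert x S)"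
  shows "insert N (insert y (insert x S)) - insert y A = insert N (insert x S) - A"
  using assms nin_S ord by auto

text \<open>The rotation is what makes the correction usable: it writes the last-letter count on the
  smaller set as a sum with the same right factors as the first-letter recurrence.\<close>

lemma first_count_diff_mid:
  assumes "\<And>A. A \<subseteq> S \<Longrightarrow>
    fc (insert x (insert y A)) x = fc (insert x (insert y A)) y + lc (insert x A) x"
  shows "first_count s (insert r (insert N (insert y (insert x S)))) x K =
         first_count s (insert r (insert N (insert y (insert x S)))) y K +
         last_count s (insert r (insert N (insert x S))) x K"
proof -
  let ?R = "insert N (insert y (insert x S))"
  have "first_count s (insert r ?R) m K = (\<Sum>A\<in>Pow (?R - {Max ?R}). fc A m * pc r (?R - A) K)"
    if "m \<noteq> r" for m
    using S ord that by (intro first_count_rec) auto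
  then have rec: "first_count s (insert r ?R) m K =
      (\<Sum>A\<in>Pow (insert y (insert x S)). fc A m * pc r (?R - A) K)" if "m \<noteq> r" for m
    unfolding Max_pair Diff_pair using that by simp
  have "last_count s (insert r (insert N (insert x S))) x K =
     (\<Sum>A\<in>Pow (insert N (insert x S) - {Max (insert N (insert x S))}).
        lc A x * pc r (insert N (insert x S) - A) K)"
  proof (rule last_count_rotate)
    show "x \<noteq> Max (insert N (insert x S))" unfolding Max_pair using ord by simp
  qed (use S ord in auto)
  also have "\<dots> = (\<Sum>A\<in>Pow (insert x S). lc A x * pc r (?R - insert y A) K)"
    unfolding Max_pair Diff_pair using Diff_insert_pair by simp
  finally have last: "last_count s (insert r (insert N (insert x S))) x K =
    (\<Sum>A\<in>Pow (insert x S). lc A x * pc r (?R - insert y A) K)" .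
  have "(\<Sum>A\<in>Pow (insert y (insert x S)). fc A x * pc r (?R - A) K) =
        (\<Sum>A\<in>Pow (insert y (insert x S)). fc A y * pc r (?R - A) K) +
        (\<Sum>A\<in>Pow (insert x S). lc A x * pc r (?R - insert y A) K)"
  proof (rule sum_Pow_split_pair)
    fix A assume A: "A \<subseteq> S"
    have "x \<notin> A" "y \<notin> A" using A nin_S by blast+
    then show "fc A x = fc A y" "lc A x = 0"
      by (simp_all add: first_count_notin last_count_notin)
    have "fc (insert x A) y = 0" "fc (insert y A) x = 0"
      using A nin_S ord by (auto intro!: first_count_notin)
    moreover have "fc (insert x A) x = fc (insert y A) y"
      using A ord by (intro fc_replace) (auto dest!: S(2))
    ultimately show "fc (insert x A) x * pc r (?R - insert x A) K +
        fc (insert y A) x * pc r (?R - insert y A) K =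
        fc (insert x A) y * pc r (?R - insert x A) K + fc (insert y A) y * pc r (?R - insert y A) K"
      using pc_swap_pair[OF A] by simp
  qed (use S nin_S ord assms in auto)
  then show ?thesis using rec[of x] rec[of y] last ord by simp
qed

lemma last_count_diff_mid:
  assumes "\<And>A. A \<subseteq> S \<Longrightarrow>
    lc (insert x (insert y A)) y = lc (insert x (insert y A)) x + fc (insert x A) x"
  shows "last_count s (insert r (insert N (insert y (insert x S)))) y K =
         last_count s (insert r (insert N (insert y (insert x S)))) x K +
         first_count s (insert r (insert N (insert x S))) x K"
proof -
  let ?R = "insert N (insert y (insert x S))"
  have "last_count s (insert r ?R) m K = (\<Sum>A\<in>Pow (?R - {Max ?R}). lc A m * pc r (?R - A) K)"
    if "m \<noteq> N" for m
  proof (rule last_count_rotate)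
    show "m \<noteq> Max ?R" unfolding Max_pair by (rule that)
  qed (use S ord in auto)
  then have rec: "last_count s (insert r ?R) m K =
      (\<Sum>A\<in>Pow (insert y (insert x S)). lc A m * pc r (?R - A) K)" if "m \<noteq> N" for m
    unfolding Max_pair Diff_pair using that by simp
  have "first_count s (insert r (insert N (insert x S))) x K =
     (\<Sum>A\<in>Pow (insert N (insert x S) - {Max (insert N (insert x S))}).
        fc A x * pc r (insert N (insert x S) - A) K)"
    using S ord by (intro first_count_rec) auto
  also have "\<dots> = (\<Sum>A\<in>Pow (insert x S). fc A x * pc r (?R - insert y A) K)"
    unfolding Max_pair Diff_pair using Diff_insert_pair by simp
  finally have first: "first_count s (insert r (insert N (insert x S))) x K =
    (\<Sum>A\<in>Pow (insert x S). fc A x * pc r (?R - insert y A) K)" .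
  have "(\<Sum>A\<in>Pow (insert y (insert x S)). lc A y * pc r (?R - A) K) =
        (\<Sum>A\<in>Pow (insert y (insert x S)). lc A x * pc r (?R - A) K) +
        (\<Sum>A\<in>Pow (insert x S). fc A x * pc r (?R - insert y A) K)"
  proof (rule sum_Pow_split_pair)
    fix A assume A: "A \<subseteq> S"
    have "x \<notin> A" "y \<notin> A" using A nin_S by blast+
    then show "lc A y = lc A x" "fc A x = 0"
      by (simp_all add: first_count_notin last_count_notin)
    have "lc (insert x A) y = 0" "lc (insert y A) x = 0"
      using A nin_S ord by (auto intro!: last_count_notin)
    moreover have "lc (insert x A) x = lc (insert y A) y"
      using A ord by (intro lc_replace) (auto dest!: S(2))
    ultimately show "lc (insert x A) y * pc r (?R - insert x A) K +
        lc (insert y A) y * pc r (?R - insert y A) K =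
        lc (insert x A) x * pc r (?R - insert x A) K + lc (insert y A) x * pc r (?R - insert y A) K"
      using pc_swap_pair[OF A] by simp
  qed (use S nin_S ord assms in auto)
  then show ?thesis using rec[of x] rec[of y] first ord by simp
qed

end

section \<open>Difference relations for two consecutive letters\<close>

lemma consecutive_cases [consumes 6, case_names min mid]:
  fixes x y :: nat
  assumes "finite Y" "x \<in> Y" "y \<in> Y" "x < y" and gap: "\<forall>a\<in>Y. a \<le> x \<or> y \<le> a"
    and "y \<noteq> Max Y"
  obtains
    T where "finite T" "T \<noteq> {}" "\<And>a. a \<in> T \<Longrightarrow> y < a" "Y = insert x (insert y T)"
  | r N S where "finite S" "\<And>a. a \<in> S \<Longrightarrow> r < a \<and> a < N \<and> (a < x \<or> y < a)" "r < x" "y < N"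
      "Y = insert r (insert N (insert y (insert x S)))"
proof -
  have ne: "Y \<noteq> {}" using assms(2) by blast
  define N where "N = Max Y"
  have N: "N \<in> Y" "\<And>a. a \<in> Y \<Longrightarrow> a \<le> N"
    using assms(1) Max_in[OF assms(1) ne] by (auto simp: N_def)
  then have yN: "y < N" using assms(3,6) by (simp add: N_def le_neq_trans)
  define r where "r = Min Y"
  have r: "r \<in> Y" "\<And>a. a \<in> Y \<Longrightarrow> r \<le> a"
    using assms(1) Min_in[OF assms(1) ne] by (auto simp: r_def)
  show ?thesis
  proof (cases "x = r")
    case True
    show ?thesis
    proof (rule that(1))
      show "finite (Y - {x, y})" using assms(1) by simp
      show "Y - {x, y} \<noteq> {}" using N yN assms(4) by auto
      show "y < a" if "a \<in> Y - {x, y}" for a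
        using that gap r(2)[of a] True by auto
      show "Y = insert x (insert y (Y - {x, y}))" using assms(2,3) by auto
    qed
  next
    case False
    show ?thesis
    proof (rule that(2))
      show "finite (Y - {r, N, x, y})" using assms(1) by simp
      show "r < x" using False r(2)[OF assms(2)] by simp
      show "y < N" by (rule yN)
      show "r < a \<and> a < N \<and> (a < x \<or> y < a)" if "a \<in> Y - {r, N, x, y}" for a
        using that gap r(2)[of a] N(2)[of a] by auto
      show "Y = insert r (insert N (insert y (insert x (Y - {r, N, x, y}))))"
        using assms(2,3) r(1) N(1) by auto
    qed
  qed
qed

text \<open>\<open>IH\<close> has no parent condition because the left block never contains the
  greatest letter, and its sets \<open>Z\<close> are proper subsets for the same reason. If
  \<open>x\<close> is the least letter, the correction is zero by
  \<open>last_count_min\<close>.\<close>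

lemma first_count_diff_step:
  assumes Y: "finite Y" "x \<in> Y" "y \<in> Y" "x < y" "\<forall>a\<in>Y. a \<le> x \<or> y \<le> a" "y \<noteq> Max Y"
    and s: "\<And>a. a \<in> Y \<Longrightarrow> s \<le> a" and K: "x \<in> K \<longleftrightarrow> y \<in> K"
    and IH: "\<And>Z. Z \<subset> Y \<Longrightarrow> x \<in> Z \<Longrightarrow> y \<in> Z \<Longrightarrow> fc Z x = fc Z y + lc (Z - {y}) x"
  shows "first_count s Y x K = first_count s Y y K + last_count s (Y - {y}) x K"
  using Y
proof (cases rule: consecutive_cases)
  case (min T)
  have "Y - {y} = insert x T" using min(3,4) \<open>x < y\<close> by auto
  moreover have "last_count s (insert x T) x K = 0"
    using min \<open>x < y\<close> s by (intro last_count_min) (auto dest: min(3))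
  moreover have "first_count s Y x K = first_count s Y y K"
    unfolding min(4) using min \<open>x < y\<close> s K by (intro first_count_diff_min) auto
  ultimately show ?thesis by simp
next
  case (mid r N S)
  have "fc (insert x (insert y A)) x = fc (insert x (insert y A)) y + lc (insert x A) x"
    if A: "A \<subseteq> S" for A
  proof -
    have "y \<notin> A" "N \<notin> A" using A mid(2) \<open>x < y\<close> by (force dest!: mid(2))+
    then have "insert x (insert y A) - {y} = insert x A" "N \<notin> insert x (insert y A)"
      using \<open>x < y\<close> \<open>y < N\<close> by auto
    moreover have "N \<in> Y" "insert x (insert y A) \<subseteq> Y" using A mid(5) by auto
    ultimately show ?thesis using IH[of "insert x (insert y A)"] by auto
  qed
  moreover have "Y - {y} = insert r (insert N (insert x S))"
    using mid(2-5) \<open>x < y\<close> by (auto dest: mid(2))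
  moreover have "s \<le> r" using s mid(5) by simp
  ultimately show ?thesis
    using first_count_diff_mid[of S r N x y s K] mid \<open>x < y\<close> K by simp
qed

lemma last_count_diff_step:
  assumes Y: "finite Y" "x \<in> Y" "y \<in> Y" "x < y" "\<forall>a\<in>Y. a \<le> x \<or> y \<le> a" "y \<noteq> Max Y"
    and s: "\<And>a. a \<in> Y \<Longrightarrow> s \<le> a" and K: "x \<in> K \<longleftrightarrow> y \<in> K"
    and IH: "\<And>Z. Z \<subset> Y \<Longrightarrow> x \<in> Z \<Longrightarrow> y \<in> Z \<Longrightarrow> lc Z y = lc Z x + fc (Z - {y}) x"
  shows "last_count s Y y K = last_count s Y x K + first_count s (Y - {y}) x K"
  using Y
proof (cases rule: consecutive_cases)
  case (min T)
  have "Y - {y} = insert x T" using min(3,4) \<open>x < y\<close> by auto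
  moreover have "last_count s Y x K = 0"
    unfolding min(4) using min \<open>x < y\<close> s by (intro last_count_min) (auto dest: min(3))
  moreover have "last_count s Y y K = first_count s (insert x T) x K"
    unfolding min(4) using min \<open>x < y\<close> s by (intro last_count_diff_min) auto
  ultimately show ?thesis by simp
next
  case (mid r N S)
  have "lc (insert x (insert y A)) y = lc (insert x (insert y A)) x + fc (insert x A) x"
    if A: "A \<subseteq> S" for A
  proof -
    have "y \<notin> A" "N \<notin> A" using A mid(2) \<open>x < y\<close> by (force dest!: mid(2))+
    then have "insert x (insert y A) - {y} = insert x A" "N \<notin> insert x (insert y A)"
      using \<open>x < y\<close> \<open>y < N\<close> by auto
    moreover have "N \<in> Y" "insert x (insert y A) \<subseteq> Y" using A mid(5) by auto
    ultimately show ?thesis using IH[of "insert x (insert y A)"] by auto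
  qed
  moreover have "Y - {y} = insert r (insert N (insert x S))"
    using mid(2-5) \<open>x < y\<close> by (auto dest: mid(2))
  moreover have "s \<le> r" using s mid(5) by simp
  ultimately show ?thesis
    using last_count_diff_mid[of S r N x y s K] mid \<open>x < y\<close> K by simp
qed

lemma consecutive_Max_cases [consumes 6, case_names pair large]:
  fixes x y :: nat
  assumes "finite Y" "x \<in> Y" "y \<in> Y" "x < y" and gap: "\<forall>a\<in>Y. a \<le> x \<or> y \<le> a"
    and "y = Max Y"
  obtains "Y = {x, y}"
  | r T where "finite T" "\<And>a. a \<in> T \<Longrightarrow> r < a \<and> a < x" "r < x" "Y = insert r (insert y (insert x T))"
proof (cases "Y = {x, y}")
  case False
  define S where "S = Y - {x, y}"
  have S: "finite S" "S \<noteq> {}" using assms(1-3) False by (auto simp: S_def)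
  have Sx: "a < x" if "a \<in> S" for a
    using that gap Max_ge[OF assms(1), of a] assms(6) by (auto simp: S_def)
  define r where "r = Min S"
  have r: "r \<in> S" "\<And>a. a \<in> S \<Longrightarrow> r \<le> a" using S by (auto simp: r_def)
  show ?thesis
  proof (rule that(2))
    show "finite (S - {r})" using S by simp
    show "r < x" using Sx r by simp
    show "r < a \<and> a < x" if "a \<in> S - {r}" for a
      using that Sx[of a] r(2)[of a] by auto
    show "Y = insert r (insert y (insert x (S - {r})))"
      using r(1) assms(2,3) by (auto simp: S_def)
  qed
qed (use that in blast)

lemma fc_diff:
  assumes "finite Y" "x \<in> Y" "y \<in> Y" "x < y" "\<forall>a\<in>Y. a \<le> x \<or> y \<le> a"
  shows "fc Y x = fc Y y + lc (Y - {y}) x"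
  using assms
proof (induction rule: finite_psubset_induct)
  case (psubset Y)
  have Y: "finite Y" "x \<in> Y" "y \<in> Y" "x < y" "\<forall>a\<in>Y. a \<le> x \<or> y \<le> a"
    using psubset by auto
  show ?case
  proof (cases "y = Max Y")
    case True
    show ?thesis using Y True
    proof (cases rule: consecutive_Max_cases)
      case pair
      have "fc {x, y} x = 1" "fc {x, y} y = 0"
        using first_count_min[of "{y}" x 0 UNIV] first_count_Max[of "{y}" x 0 UNIV] \<open>x < y\<close> by auto
      moreover have "{x, y} - {y} = {x}" using \<open>x < y\<close> by auto
      ultimately show ?thesis using pair by simp
    next
      case (large r T)
      have nin: "x \<notin> T" "y \<notin> T" "r \<noteq> y" using large(2,3) \<open>x < y\<close> by (auto dest: large(2))
      have Max: "Max (insert y (insert x T)) = y"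
        using large(1) \<open>x < y\<close> by (intro Max_eqI) (auto dest!: large(2))
      have "fc Y x = num (insert y T)"
        unfolding large(4) using large \<open>x < y\<close>
        by (subst first_count_second_max) (auto simp: par_count_UNIV)
      \<comment> \<open>Two sets of equal size: the greatest letter \<open>y\<close> is traded for
        the least letter \<open>r\<close>, so that \<open>x\<close> can be put on top and
        \<open>lc_Max\<close> applied.\<close>
      also have "\<dots> = num (insert r T)"
        using large \<open>x < y\<close> by (intro num_shift) (auto dest!: large(2))
      also have "\<dots> = lc (insert x (insert r T)) x"
        using large by (subst lc_Max) auto
      also have "insert x (insert r T) = Y - {y}"
        using large(4) nin \<open>x < y\<close> by auto
      finally have "fc Y x = lc (Y - {y}) x" .
      moreover have "fc Y y = 0"
      proof -
        have "r < z" if "z \<in> insert y (insert x T)" for z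
          using that large(2)[of z] \<open>r < x\<close> \<open>x < y\<close> by auto
        then show ?thesis
          using first_count_Max[of "insert y (insert x T)" r 0 UNIV] large(1)
          unfolding Max large(4) by simp
      qed
      ultimately show ?thesis by simp
    qed
  next
    case False
    show ?thesis
      using Y False by (rule first_count_diff_step) (use psubset.IH Y in auto)
  qed
qed

lemma lc_diff:
  assumes "finite Y" "x \<in> Y" "y \<in> Y" "x < y" "\<forall>a\<in>Y. a \<le> x \<or> y \<le> a"
  shows "lc Y y = lc Y x + fc (Y - {y}) x"
  using assms
proof (induction rule: finite_psubset_induct)
  case (psubset Y)
  have Y: "finite Y" "x \<in> Y" "y \<in> Y" "x < y" "\<forall>a\<in>Y. a \<le> x \<or> y \<le> a"
    using psubset by auto
  show ?case
  proof (cases "y = Max Y")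
    case True
    show ?thesis using Y True
    proof (cases rule: consecutive_Max_cases)
      case pair
      have "lc {y, x} y = 1" "lc {x, y} x = 0"
        using lc_Max[of "{x}" y] last_count_min[of "{y}" x 0 UNIV] \<open>x < y\<close> by auto
      moreover have "{x, y} - {y} = {x}" using \<open>x < y\<close> by auto
      ultimately show ?thesis using pair by (simp add: insert_commute)
    next
      case (large r T)
      have nin: "x \<notin> T" "y \<notin> T" "r \<noteq> y" using large(2,3) \<open>x < y\<close> by (auto dest: large(2))
      have Max: "Max (insert x T) = x"
        using large(1) by (intro Max_eqI) (auto dest!: large(2))
      have Yy: "Y - {y} = insert r (insert x T)" "Y = insert y (insert r (insert x T))"
        using large(4) nin \<open>x < y\<close> by auto
      \<comment> \<open>With \<open>x\<close> and \<open>y\<close> the two greatest letters, both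
        last-letter counts equal the number of words on \<open>Y - {y}\<close>. The correction
        vanishes because \<open>x\<close> is the greatest letter there.\<close>
      have "lc Y y = num (insert r (insert x T))"
        unfolding Yy(2) using large \<open>x < y\<close> by (intro lc_Max) (auto dest!: large(2))
      moreover have "lc Y x = num (insert r (insert x T))"
        unfolding large(4) using large \<open>x < y\<close> by (intro last_count_second_max) auto
      moreover have "fc (Y - {y}) x = 0"
      proof -
        have "r < z" if "z \<in> insert x T" for z
          using that large(2)[of z] \<open>r < x\<close> by auto
        then show ?thesis
          using first_count_Max[of "insert x T" r 0 UNIV] large(1) unfolding Max Yy(1) by simp
      qed
      ultimately show ?thesis by simp
    qed
  next
    case False
    show ?thesis
      using Y False by (rule last_count_diff_step) (use psubset.IH Y in auto)
  qed
qed

lemma first_count_diff: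
  assumes "finite Y" "x \<in> Y" "y \<in> Y" "x < y" "\<forall>a\<in>Y. a \<le> x \<or> y \<le> a" "y \<noteq> Max Y"
    and "\<And>a. a \<in> Y \<Longrightarrow> s \<le> a" "x \<in> K \<longleftrightarrow> y \<in> K"
  shows "first_count s Y x K = first_count s Y y K + last_count s (Y - {y}) x K"
  using assms by (rule first_count_diff_step) (use assms in \<open>auto intro!: fc_diff intro: finite_subset\<close>)

lemma last_count_diff:
  assumes "finite Y" "x \<in> Y" "y \<in> Y" "x < y" "\<forall>a\<in>Y. a \<le> x \<or> y \<le> a" "y \<noteq> Max Y"
    and "\<And>a. a \<in> Y \<Longrightarrow> s \<le> a" "x \<in> K \<longleftrightarrow> y \<in> K"
  shows "last_count s Y y K = last_count s Y x K + first_count s (Y - {y}) x K"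
  using assms by (rule last_count_diff_step) (use assms in \<open>auto intro!: lc_diff intro: finite_subset\<close>)

subsection \<open>The twin Seidel matrices\<close>

text \<open>The difference relations never cross the diagonal, so each triangle is filled
  separately: above the diagonal downwards from row 1, below it upwards from the bottom. The
  diagonal and the last column are prescribed.\<close>

lemma twin_seidel_unique:
  assumes "twin_seidel a b" "twin_seidel a' b'" "n \<ge> 2"
  shows "\<forall>m\<in>{1..n}. \<forall>k\<in>{1..n}. a n m k = a' n m k \<and> b n m k = b' n m k"
  using \<open>n \<ge> 2\<close>
proof (induction n rule: dec_induct)
  case base
  have "{1..2} = {1, 2 :: nat}" by auto
  then show ?case using assms unfolding twin_seidel_def TS3_def by simp
next
  case (step n)
  let ?n = "Suc n"
  have n: "?n \<ge> 3" using step.hyps by simp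
  have TS: "TS1 a b" "TS2 a b" "TS4 a b" "TS5 a b" "TS1 a' b'" "TS2 a' b'" "TS4 a' b'" "TS5 a' b'"
    using assms unfolding twin_seidel_def by blast+
  have IH: "a n m k = a' n m k" "b n m k = b' n m k" if "m \<in> {1..n}" "k \<in> {1..n}" for m k
    using step.IH that by auto
  have col: "col_sum a n k = col_sum a' n k" "col_sum b n k = col_sum b' n k" if "k \<in> {1..n}" for k
    unfolding col_sum_def using IH that by auto
  have diag: "a ?n m m = a' ?n m m" "b ?n m m = b' ?n m m" if "m \<in> {1..?n}" for m
    using TS(1,5) that n unfolding TS1_def by auto
  have zero: "a ?n m ?n = a' ?n m ?n" "b ?n m ?n = b' ?n m ?n"
     "a ?n ?n m = a' ?n ?n m" "b ?n 1 m = b' ?n 1 m" "b ?n ?n 1 = b' ?n ?n 1" if "m \<in> {1..?n}" for m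
    using TS(2,6) that n unfolding TS2_def by auto
  have TS4_n: "2 \<le> k \<Longrightarrow> k \<le> n \<Longrightarrow> c ?n ?n k = col_sum d n (k - 1)"
      "1 \<le> k \<Longrightarrow> k \<le> n - 1 \<Longrightarrow> c ?n n k = col_sum d n k"
      "1 \<le> k \<Longrightarrow> k + 1 \<le> m \<Longrightarrow> m < n \<Longrightarrow>
         int (c ?n (m + 1) k) - int (c ?n m k) = int (d n m k)"
      "1 \<le> m \<Longrightarrow> m + 2 \<le> k \<Longrightarrow> k \<le> n \<Longrightarrow>
         int (c ?n (m + 1) k) - int (c ?n m k) = int (d n m (k - 1))"
    if "TS4 d c" for c d :: matrix_seq and m k
    using that[unfolded TS4_def, rule_format, OF n] by auto
  have TS5_n: "2 \<le> k \<Longrightarrow> k \<le> n \<Longrightarrow> c ?n 1 k = col_sum d n (k - 1)"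
      "1 \<le> m \<Longrightarrow> m + 2 \<le> k \<Longrightarrow> k \<le> n \<Longrightarrow>
         int (c ?n (m + 1) k) - int (c ?n m k) = - int (d n m (k - 1))"
      "1 \<le> k \<Longrightarrow> k + 1 \<le> m \<Longrightarrow> m \<le> n \<Longrightarrow>
         int (c ?n (m + 1) k) - int (c ?n m k) = - int (d n m k)"
    if "TS5 c d" for c d :: matrix_seq and m k
    using that[unfolded TS5_def, rule_format, OF n] by auto
  have pred: "k - 1 \<in> {1..n}" if "2 \<le> k" "k \<le> n" for k
    using that by auto
  have b_top: "b ?n ?n k = b' ?n ?n k" if "2 \<le> k" "k \<le> n" for k
    using TS4_n(1)[OF TS(3) that] TS4_n(1)[OF TS(7) that] col(1)[OF pred] that by auto
  have b_second: "b ?n n k = b' ?n n k" if "1 \<le> k" "k \<le> n - 1" for k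
    using TS4_n(2)[OF TS(3) that] TS4_n(2)[OF TS(7) that] col(1)[of k] that by auto
  have a_top: "a ?n 1 k = a' ?n 1 k" if "2 \<le> k" "k \<le> n" for k
    using TS5_n(1)[OF TS(4) that] TS5_n(1)[OF TS(8) that] col(2)[OF pred] that by auto
  have a1: "a ?n m k = a' ?n m k" if "1 \<le> m" "m < k" "k \<le> n" for m k
    using that
  proof (induction m rule: dec_induct)
    case base
    then show ?case using a_top by simp
  next
    case (step m)
    then show ?case
      using TS5_n(2)[OF TS(4), of m k] TS5_n(2)[OF TS(8), of m k] IH(2)[OF _ pred, of m k] by simp
  qed
  have a2: "a ?n m k = a' ?n m k" if "m \<le> ?n" "1 \<le> k" "k < m" for m k
    using that(1,2,3)
  proof (induction m rule: inc_induct)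
    case base
    then show ?case using zero by simp
  next
    case (step m)
    then show ?case
      using TS5_n(3)[OF TS(4), of k m] TS5_n(3)[OF TS(8), of k m] IH(2)[of m k] by simp
  qed
  have b1: "b ?n m k = b' ?n m k" if "1 \<le> m" "m < k" "k \<le> n" for m k
    using that
  proof (induction m rule: dec_induct)
    case base
    then show ?case using zero(4)[of k] by simp
  next
    case (step m)
    then show ?case
      using TS4_n(4)[OF TS(3), of m k] TS4_n(4)[OF TS(7), of m k] IH(1)[OF _ pred, of m k] by simp
  qed
  \<comment> \<open>The start is row \<open>n\<close> of the matrix of dimension
    \<open>Suc n\<close>: below the diagonal the differences of \<open>b\<close> stop at this row,
    and the last row is given by \<open>b_top\<close> and, for \<open>k = 1\<close>, by TS2.\<close>
  have b2: "b ?n m k = b' ?n m k" if "m \<le> n" "1 \<le> k" "k < m" for m k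
    using that(1,2,3)
  proof (induction m rule: inc_induct)
    case base
    then show ?case using b_second by simp
  next
    case (step m)
    then show ?case
      using TS4_n(3)[OF TS(3), of k m] TS4_n(3)[OF TS(7), of k m] IH(1)[of m k] by simp
  qed
  show ?case
  proof (intro ballI)
    fix m k assume mk: "m \<in> {1..?n}" "k \<in> {1..?n}"
    consider "k = ?n" | "k = m" | "m < k" "k \<le> n" | "k < m" "m \<le> n" | "k < m" "m = ?n"
      using mk by fastforce
    then show "a ?n m k = a' ?n m k \<and> b ?n m k = b' ?n m k"
    proof cases
      case 1
      then show ?thesis using zero mk by simp
    next
      case 2
      then show ?thesis using diag mk by simp
    next
      case 3
      then show ?thesis using a1 b1 mk by simp
    next
      case 4
      then show ?thesis using a2 b2 mk by simp
    next
      case 5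
      then show ?thesis using a2 b_top[of k] zero(5)[of k] mk by (cases "k = 1") simp_all
    qed
  qed
qed

section \<open>Vanishing entries\<close>

lemma first_count_zero:
  assumes "finite Y" "Y \<noteq> {}" "K \<inter> insert s (Y - {Max Y}) = {}"
  shows "first_count s Y m K = 0"
proof -
  have "{w \<in> andre_words Max Y. nbr s (Max Y) w \<in> K} = {}"
    using par_count_zero[OF assms, of Max] by (simp add: par_count_def)
  then show ?thesis unfolding first_count_def by (auto simp: card_eq_0_iff)
qed

lemma last_count_zero:
  assumes "finite Y" "Y \<noteq> {}" "K \<inter> insert s (Y - {Max Y}) = {}"
  shows "last_count s Y m K = 0"
proof -
  have "{w \<in> andre_words Min Y. nbr s (Max Y) w \<in> K} = {}"
    using par_count_zero[OF assms, of Min] by (simp add: par_count_def)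
  then show ?thesis unfolding last_count_def by (auto simp: card_eq_0_iff)
qed

text \<open>A first letter \<open>m\<close> other than the root is in the left block, whereas the
  parent of the greatest letter is \<open>r\<close> or in the right block.\<close>

lemma first_count_diagonal:
  assumes "finite R" "R \<noteq> {}" "\<And>x. x \<in> R \<Longrightarrow> r < x" "s \<le> r" "m \<noteq> r"
  shows "first_count s (insert r R) m {m} = 0"
proof -
  have "fc A m * pc r (R - A) {m} = 0" if "A \<in> Pow (R - {Max R})" for A
  proof (cases "m \<in> A")
    case True
    have "Max R \<in> R - A" using Max_in[OF assms(1,2)] that by blast
    then have "pc r (R - A) {m} = 0"
      using True assms(1,5) by (intro par_count_zero) auto
    then show ?thesis by simp
  qed (simp add: first_count_notin)
  then have "(\<Sum>A\<in>Pow (R - {Max R}). fc A m * pc r (R - A) {m}) = 0" by (intro sum.neutral) blast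
  then show ?thesis using first_count_rec[OF assms, of "{m}"] by simp
qed

text \<open>After rotation the last letter and the parent of the greatest letter are sought in
  disjoint sets. The case \<open>m = Max R\<close>, outside the scope of the rotation, goes back to
  \<open>last_count_Max\<close>.\<close>

lemma last_count_diagonal:
  assumes "finite R" "R \<noteq> {}" "\<And>x. x \<in> R \<Longrightarrow> r < x" "s \<le> r"
  shows "last_count s (insert r R) m {m} = 0"
proof (cases "m = Max R")
  case True
  have "m \<notin> insert r (R - {Max R})" using True assms(3) Max_in[OF assms(1,2)] by auto
  then show ?thesis using last_count_Max[OF assms, of m] True by (simp add: last_count_notin)
next
  case False
  have "lc A m * pc r (R - A) {m} = 0" if "A \<in> Pow (R - {Max R})" for A
  proof (cases "m \<in> A")
    case True
    then have "m \<noteq> r" using that assms(3) by blast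
    have "Max R \<in> R - A" using Max_in[OF assms(1,2)] that by blast
    then have "pc r (R - A) {m} = 0"
      using True assms(1) \<open>m \<noteq> r\<close> by (intro par_count_zero) auto
    then show ?thesis by simp
  qed (simp add: last_count_notin)
  then have "(\<Sum>A\<in>Pow (R - {Max R}). lc A m * pc r (R - A) {m}) = 0" by (intro sum.neutral) blast
  then show ?thesis using last_count_rotate[OF assms False, of "{m}"] by simp
qed

section \<open>The counting matrices and their relations\<close>

definition A_count :: matrix_seq where
  "A_count n m k = first_count 0 {1..n} m {k}"

definition B_count :: matrix_seq where
  "B_count n m k = last_count 0 {1..n} m {k}"

lemma interval_insert_1: "n \<ge> 1 \<Longrightarrow> {1..n} = insert 1 {2..n :: nat}"
  by auto

lemma Max_interval: "n \<ge> m \<Longrightarrow> Max {m..n :: nat} = n"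
  by (intro Max_eqI) auto

text \<open>Renaming by \<open>Suc\<close> carries the default \<open>0\<close> to the root
  \<open>1\<close>. It is the origin of the index \<open>k - 1\<close> in the column sums of TS4 and
  TS5.\<close>

lemma pc_shift:
  assumes "n \<ge> 2" "k \<ge> 2"
  shows "pc 1 {2..n} {k} = pc 0 {1..n - 1} {k - 1}"
proof -
  have im: "Suc ` {1..n - 1} = {2..n}"
    using assms(1) by (simp add: image_Suc_atLeastAtMost numeral_2_eq_2)
  have "pc (Suc 0) (Suc ` {1..n - 1}) {k} = pc 0 {1..n - 1} {k - 1}"
    using assms by (intro par_count_image) (auto simp: strict_mono_on_def)
  then show ?thesis unfolding im by simp
qed

lemma col_sum_A_count: "n \<ge> 1 \<Longrightarrow> col_sum A_count n k = pc 0 {1..n} {k}"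
  unfolding col_sum_def A_count_def by (rule sum_first_count) auto

lemma col_sum_B_count: "n \<ge> 1 \<Longrightarrow> col_sum B_count n k = pc 0 {1..n} {k}"
  unfolding col_sum_def B_count_def by (rule sum_last_count) auto

lemma A_count_first_row:
  assumes "n \<ge> 2"
  shows "A_count n 1 k = pc 1 {2..n} {k}"
  unfolding A_count_def using assms interval_insert_1[of n] first_count_min[of "{2..n}" 1 0 "{k}"]
  by simp

lemma B_count_last_row:
  assumes "n \<ge> 2"
  shows "B_count n n k = lc {1..n - 1} k"
proof -
  have "insert 1 ({2..n} - {n}) = {1..n - 1}" using assms by auto
  then show ?thesis
    unfolding B_count_def
    using assms interval_insert_1[of n] last_count_Max[of "{2..n}" 1 0 k] Max_interval[of 2 n]
    by simp
qed

text \<open>The order isomorphism that reinserts the deleted letter \<open>m + 1\<close>. It fixes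
  \<open>m\<close> and the default \<open>0\<close>; columns left of the diagonal are kept and those
  right of it shift by one, so one statement covers both difference relations.\<close>

definition skip :: "nat \<Rightarrow> nat \<Rightarrow> nat" where
  "skip m i = (if i \<le> m then i else i + 1)"

lemma skip_mono: "strict_mono_on X (skip m)"
  by (auto simp: strict_mono_on_def skip_def)

lemma skip_image:
  assumes "m < n"
  shows "skip m ` {1..n - 1} = {1..n} - {m + 1}"
proof (intro equalityI subsetI)
  fix i assume i: "i \<in> {1..n} - {m + 1}"
  show "i \<in> skip m ` {1..n - 1}"
  proof (cases "i \<le> m")
    case True
    then show ?thesis using i assms by (intro image_eqI[of _ _ i]) (auto simp: skip_def)
  next
    case False
    then show ?thesis using i assms by (intro image_eqI[of _ _ "i - 1"]) (auto simp: skip_def)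
  qed
qed (use assms in \<open>auto simp: skip_def\<close>)

lemma A_count_skip:
  assumes "1 \<le> m" "m < n"
  shows "first_count 0 ({1..n} - {m + 1}) m {skip m k} = A_count (n - 1) m k"
proof -
  have "first_count (skip m 0) (skip m ` {1..n - 1}) (skip m m) {skip m k} =
        first_count 0 {1..n - 1} m {k}"
    using assms by (intro first_count_image skip_mono) (auto simp: skip_def split: if_splits)
  then show ?thesis unfolding skip_image[OF assms(2)] A_count_def by (simp add: skip_def)
qed

lemma B_count_skip:
  assumes "1 \<le> m" "m < n"
  shows "last_count 0 ({1..n} - {m + 1}) m {skip m k} = B_count (n - 1) m k"
proof -
  have "last_count (skip m 0) (skip m ` {1..n - 1}) (skip m m) {skip m k} =
        last_count 0 {1..n - 1} m {k}"
    using assms by (intro last_count_image skip_mono) (auto simp: skip_def split: if_splits)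
  then show ?thesis unfolding skip_image[OF assms(2)] B_count_def by (simp add: skip_def)
qed

text \<open>For \<open>k\<close> off the diagonal, \<open>skip m k\<close> is neither
  \<open>m\<close> nor \<open>m + 1\<close>, so the singleton contains neither of the exchanged
  letters.\<close>

lemma A_count_diff:
  assumes "1 \<le> m" "m + 1 < n" "k \<noteq> m"
  shows "A_count n m (skip m k) = A_count n (m + 1) (skip m k) + B_count (n - 1) m k"
proof -
  have "skip m k \<noteq> m" "skip m k \<noteq> m + 1" using assms by (auto simp: skip_def)
  then have "first_count 0 {1..n} m {skip m k} =
      first_count 0 {1..n} (m + 1) {skip m k} + last_count 0 ({1..n} - {m + 1}) m {skip m k}"
    using assms Max_interval[of 1 n] by (intro first_count_diff) auto
  then show ?thesis using B_count_skip[of m n k] assms by (simp add: A_count_def)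
qed

lemma B_count_diff:
  assumes "1 \<le> m" "m + 1 < n" "k \<noteq> m"
  shows "B_count n (m + 1) (skip m k) = B_count n m (skip m k) + A_count (n - 1) m k"
proof -
  have "skip m k \<noteq> m" "skip m k \<noteq> m + 1" using assms by (auto simp: skip_def)
  then have "last_count 0 {1..n} (m + 1) {skip m k} =
      last_count 0 {1..n} m {skip m k} + first_count 0 ({1..n} - {m + 1}) m {skip m k}"
    using assms Max_interval[of 1 n] by (intro last_count_diff) auto
  then show ?thesis using A_count_skip[of m n k] assms by (simp add: B_count_def)
qed

lemma interval_second_max: "n \<ge> 3 \<Longrightarrow> {1..n} = insert 1 (insert n (insert (n - 1) {2..n - 2 :: nat}))"
  by auto

text \<open>This serves the step \<open>m = n - 1\<close> of TS5, where the exchanged letter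
  \<open>m + 1\<close> is the greatest one and \<open>first_count_diff\<close> does not
  apply.\<close>

lemma A_count_second_max:
  assumes "n \<ge> 3"
  shows "A_count n (n - 1) k = B_count (n - 1) (n - 1) k"
proof -
  have "A_count n (n - 1) k = pc 1 (insert n {2..n - 2}) {k}"
    unfolding A_count_def interval_second_max[OF assms] using assms
    by (intro first_count_second_max) auto
  also have "\<dots> = lc (insert 1 {2..n - 2}) k"
    using assms by (intro lc_eq_pc[symmetric]) auto
  also have "insert 1 {2..n - 2} = {1..n - 1 - 1}" using assms by auto
  also have "lc \<dots> k = B_count (n - 1) (n - 1) k"
    using assms by (intro B_count_last_row[symmetric]) auto
  finally show ?thesis .
qed

text \<open>The bound on \<open>k\<close> keeps both \<open>n - 1\<close> and \<open>n\<close> out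
  of \<open>{k}\<close>, as the renaming in \<open>last_count_second_max\<close> demands.\<close>

lemma B_count_second_max:
  assumes "n \<ge> 3" "k \<le> n - 2"
  shows "B_count n (n - 1) k = pc 0 {1..n - 1} {k}"
proof -
  have "B_count n (n - 1) k = pc 0 (insert 1 (insert (n - 1) {2..n - 2})) {k}"
    unfolding B_count_def interval_second_max[OF assms(1)] using assms
    by (intro last_count_second_max) auto
  also have "insert 1 (insert (n - 1) {2..n - 2}) = {1..n - 1}" using assms by auto
  finally show ?thesis .
qed

lemma A_count_2: "A_count 2 1 k = (if k = 1 then 1 else 0)" "A_count 2 2 k = 0"
proof -
  have "{1..2} = insert 1 {2 :: nat}" by auto
  then show "A_count 2 1 k = (if k = 1 then 1 else 0)" "A_count 2 2 k = 0"
    using first_count_min[of "{2}" 1 0 "{k}"] first_count_Max[of "{2}" 1 0 "{k}"]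
    by (auto simp: A_count_def)
qed

lemma A_count_last_row:
  assumes "n \<ge> 2"
  shows "A_count n n k = 0"
  unfolding A_count_def
  using assms interval_insert_1[of n] first_count_Max[of "{2..n}" 1 0 "{k}"] Max_interval[of 2 n]
  by simp

lemma B_count_first_row:
  assumes "n \<ge> 2"
  shows "B_count n 1 k = 0"
  unfolding B_count_def
  using assms interval_insert_1[of n] last_count_min[of "{2..n}" 1 0 "{k}"] by simp

lemma B_count_diagonal:
  assumes "n \<ge> 2"
  shows "B_count n m m = 0"
  unfolding B_count_def
  using assms interval_insert_1[of n] last_count_diagonal[of "{2..n}" 1 0 m] by simp

lemma A_count_diagonal:
  assumes "n \<ge> 3"
  shows "A_count n m m = 0"
proof (cases "m = 1")
  case True
  have "insert 2 {3..n} = {2..n}" using assms by auto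
  \<comment> \<open>Since \<open>n\<close> is at least 3, the root 2 of the tree on
    \<open>{2..n}\<close> separates the letter \<open>n\<close> from 1, so 1 cannot be its
    parent.\<close>
  have "pc 1 {2..n} {1} = 0"
  proof -
    have "pc 2 ({3..n} - A) {1} = 0" if "A \<in> Pow ({3..n} - {n})" for A
    proof (rule par_count_zero)
      show "{3..n} - A \<noteq> {}" using that assms by auto
    qed auto
    then show ?thesis
      using par_count_rec_I[of "{3..n}" 2 1 "{1}"] assms Max_interval[of 3 n]
        \<open>insert 2 {3..n} = {2..n}\<close> by simp
  qed
  then show ?thesis using True A_count_first_row[of n 1] assms by simp
next
  case False
  then show ?thesis
    unfolding A_count_def
    using assms interval_insert_1[of n] first_count_diagonal[of "{2..n}" 1 0 m] by simp
qed

lemma twin_seidel_counts: "twin_seidel A_count B_count"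
proof -
  have B2: "B_count 2 2 k = (if k = 1 then 1 else 0)" for k
    using B_count_last_row[of 2 k] by simp
  have TS1: "TS1 A_count B_count"
    unfolding TS1_def
  proof (intro allI impI ballI)
    fix n m :: nat assume n: "n \<ge> 2" "m \<in> {1..n}"
    show "A_count n m m = (if n = 2 \<and> m = 1 then 1 else 0) \<and> B_count n m m = 0"
    proof (cases "n = 2")
      case True
      then have "m = 1 \<or> m = 2" using n by auto
      then show ?thesis using True B_count_diagonal[of n m] A_count_2 by auto
    next
      case False
      then show ?thesis using n A_count_diagonal[of n m] B_count_diagonal[of n m] by simp
    qed
  qed
  have TS2: "TS2 A_count B_count"
    unfolding TS2_def
  proof (intro allI impI ballI conjI)
    fix n m :: nat assume n: "n \<ge> 3"
    have "Max {1..n} = n" using n by (simp add: Max_interval)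
    then show "A_count n m n = 0" "B_count n m n = 0"
      using n unfolding A_count_def B_count_def
      by (auto intro!: first_count_zero last_count_zero)
    show "A_count n n m = 0" "B_count n 1 m = 0"
      using n A_count_last_row B_count_first_row by simp_all
    have "{1..n - 1} = insert 1 {2..n - 1}" "{2..n - 1} \<noteq> {}" using n by auto
    then have "lc {1..n - 1} 1 = 0" using last_count_min[of "{2..n - 1}" 1 0 UNIV] by simp
    then show "B_count n n 1 = 0" using B_count_last_row[of n 1] n by simp
  qed
  have TS3: "TS3 A_count B_count"
    unfolding TS3_def using A_count_2 B2 B_count_first_row[of 2] by simp
  have TS4: "TS4 A_count B_count"
    unfolding TS4_def
  proof (intro allI impI conjI)
    fix n k :: nat assume n: "n \<ge> 3" and k: "2 \<le> k \<and> k \<le> n - 1"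
    have "B_count n n k = lc (insert 1 {2..n - 1}) k"
      using B_count_last_row[of n k] interval_insert_1[of "n - 1"] n by simp
    \<comment> \<open>Here \<open>n\<close> is the new leaf \<open>z\<close> of
      \<open>lc_eq_pc\<close>: the last letter \<open>k\<close> turns into the parent of
      \<open>n\<close>.\<close>
    also have "\<dots> = pc 1 (insert n {2..n - 1}) {k}"
      using n by (intro lc_eq_pc) auto
    also have "insert n {2..n - 1} = {2..n}" using n by auto
    also have "pc 1 {2..n} {k} = col_sum A_count (n - 1) (k - 1)"
      using pc_shift[of n k] col_sum_A_count[of "n - 1" "k - 1"] n k by simp
    finally show "B_count n n k = col_sum A_count (n - 1) (k - 1)" .
  next
    fix n k :: nat assume "n \<ge> 3" "1 \<le> k \<and> k \<le> n - 2"
    then show "B_count n (n - 1) k = col_sum A_count (n - 1) k"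
      using B_count_second_max[of n k] col_sum_A_count[of "n - 1" k] by simp
  next
    fix n m k :: nat assume n: "n \<ge> 3" and mk: "2 \<le> k + 1 \<and> k + 1 \<le> m \<and> m \<le> n - 2"
    then have "skip m k = k" "m + 1 < n" by (auto simp: skip_def)
    then show "int (B_count n (m + 1) k) - int (B_count n m k) = int (A_count (n - 1) m k)"
      using B_count_diff[of m n k] n mk by simp
  next
    fix n m k :: nat assume n: "n \<ge> 3" and mk: "3 \<le> m + 2 \<and> m + 2 \<le> k \<and> k \<le> n - 1"
    then have "skip m (k - 1) = k" "m + 1 < n" "k - 1 \<noteq> m" by (auto simp: skip_def)
    then show "int (B_count n (m + 1) k) - int (B_count n m k) = int (A_count (n - 1) m (k - 1))"
      using B_count_diff[of m n "k - 1"] n mk by simp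
  qed
  have TS5: "TS5 A_count B_count"
    unfolding TS5_def
  proof (intro allI impI conjI)
    fix n k :: nat assume n: "n \<ge> 3" and k: "2 \<le> k \<and> k \<le> n - 1"
    then show "A_count n 1 k = col_sum B_count (n - 1) (k - 1)"
      using A_count_first_row[of n k] pc_shift[of n k] col_sum_B_count[of "n - 1" "k - 1"] by simp
  next
    fix n m k :: nat assume n: "n \<ge> 3" and mk: "3 \<le> m + 2 \<and> m + 2 \<le> k \<and> k \<le> n - 1"
    then have "skip m (k - 1) = k" "m + 1 < n" "k - 1 \<noteq> m" by (auto simp: skip_def)
    then show "int (A_count n (m + 1) k) - int (A_count n m k) = - int (B_count (n - 1) m (k - 1))"
      using A_count_diff[of m n "k - 1"] n mk by simp
  next
    fix n m k :: nat assume n: "n \<ge> 3" and mk: "2 \<le> k + 1 \<and> k + 1 \<le> m \<and> m \<le> n - 1"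
    then have skip: "skip m k = k" by (simp add: skip_def)
    show "int (A_count n (m + 1) k) - int (A_count n m k) = - int (B_count (n - 1) m k)"
    proof (cases "m = n - 1")
      case True
      then show ?thesis using A_count_second_max[of n k] A_count_last_row[of n k] n by simp
    next
      case False
      then have "m + 1 < n" using mk by auto
      then show ?thesis using A_count_diff[of m n k] mk skip by simp
    qed
  qed
  show ?thesis unfolding twin_seidel_def using TS1 TS2 TS3 TS4 TS5 by blast
qed

section \<open>From neighbours of the greatest letter to the statistics of words\<close>

lemma last_andre_by_Max: "andre_by Max w \<Longrightarrow> w \<noteq> [] \<Longrightarrow> last w = Max (set w)"
proof (induction rule: andre_by.induct)
  case (split v x v')
  then have v': "v' \<noteq> []" by auto
  have "Max (set (v @ x # v')) = max x (Max (set (v @ v')))"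
    using split.hyps(2) Max_insert[of "set (v @ v')" x] by simp
  moreover have "x \<le> Max (set (v @ v'))"
  proof -
    have "Max (set (v @ v')) \<in> set (v @ x # v')" using split.hyps(6) by auto
    then show ?thesis using split.hyps(3) by (metis List.finite_set Min_le)
  qed
  moreover have "Max (set v') = Max (set (v @ v'))"
    using split.hyps(6) by (intro Max_eqI) auto
  ultimately show ?case using split.IH(2) v' by (simp add: max_def)
qed auto

lemma And_I_eq: "And_I n = andre_words Max {1..n}"
  unfolding And_I_def andre_words_def permutations_of_set_def andre_I_eq by auto

lemma And_II_eq: "And_II n = andre_words Min {1..n}"
  unfolding And_II_def andre_words_def permutations_of_set_def andre_II_eq by auto

lemma length_andre_words: "w \<in> andre_words sel {1..n} \<Longrightarrow> length w = n"
  unfolding andre_words_def using distinct_card[of w] by auto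

text \<open>\<open>x\<close> stands at the 1-based position \<open>length p + 1\<close>, so these
  are its two neighbours; the default \<open>0\<close> is the boundary convention of
  \<open>letter\<close>.\<close>

lemma letter_append_Cons:
  "letter (p @ x # q) (length p) = last (0 # p)"
  "letter (p @ x # q) (length p + 2) = hd (q @ [0])"
  by (cases p rule: rev_cases; auto simp: letter_def nth_append)
     (cases q; auto simp: letter_def nth_append)

text \<open>An Andre I word ends in its greatest letter, whose only real neighbour is the letter
  before it. For \<open>n = 1\<close> both sides are the boundary value \<open>0\<close>.\<close>

lemma NL_stat_eq_nbr:
  assumes "w \<in> andre_words Max {1..n}" "n \<ge> 1"
  shows "NL_stat w = nbr 0 n w"
proof -
  have w: "set w = {1..n}" "distinct w" "andre_by Max w"
    using assms(1) by (auto simp: andre_words_def)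
  then have ne: "w \<noteq> []" using assms(2) by auto
  then have "last w = n" using last_andre_by_Max[of w] Max_interval[of 1 n] w assms(2) by simp
  then obtain u where u: "w = u @ n # []" using ne by (metis append_butlast_last_id)
  then have "NL_stat w = last (0 # u)"
    using letter_append_Cons(1)[of u n "[]"] by (simp add: NL_stat_def)
  moreover have "nbr 0 n w = last (0 # u)"
    using nbr_append[of n u 0 "[]"] w(2) u by simp
  ultimately show ?thesis by simp
qed

lemma grn_eq_nbr:
  assumes "w \<in> andre_words sel {1..n}" "n \<ge> 1"
  shows "grn w = nbr 0 n w"
proof -
  have w: "set w = {1..n}" "distinct w" "length w = n"
    using assms length_andre_words by (auto simp: andre_words_def)
  then have "n \<in> set w" using assms(2) by simp
  then obtain p q where pq: "w = p @ n # q" by (meson split_list)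
  have "(THE i. 1 \<le> i \<and> i \<le> length w \<and> letter w i = length w) = length p + 1"
  proof (rule the_equality)
    show "1 \<le> length p + 1 \<and> length p + 1 \<le> length w \<and> letter w (length p + 1) = length w"
      using w(3) by (simp add: pq letter_def)
    fix i assume i: "1 \<le> i \<and> i \<le> length w \<and> letter w i = length w"
    then have "w ! (i - 1) = w ! length p" "i - 1 < length w" "length p < length w"
      using w(3) by (auto simp: letter_def pq)
    then have "i - 1 = length p" using w(2) nth_eq_iff_index_eq by blast
    then show "i = length p + 1" using conjunct1[OF i] by linarith
  qed
  then have "grn w = max (last (0 # p)) (hd (q @ [0]))"
    unfolding grn_def using letter_append_Cons[of p n q] by (simp add: pq)
  then show ?thesis using nbr_append[of n p 0 q] w(2) pq by simp
qed

theorem theorem1p2: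
  fixes a b :: matrix_seq and n m k :: nat
  assumes "twin_seidel a b"
    and "n \<ge> 2"
    and "1 \<le> m" and "m \<le> n"
    and "1 \<le> k" and "k \<le> n"
  shows "a n m k = card {w \<in> And_I n. (F_stat w, NL_stat w) = (m, k)}
       \<and> b n m k = card {w \<in> And_II n. (L_stat w, grn w) = (m, k)}"
proof -
  have Max: "Max {1..n} = n" using assms(2) by (simp add: Max_interval)
  have "{w \<in> And_I n. (F_stat w, NL_stat w) = (m, k)} =
        {w \<in> andre_words Max {1..n}. w \<noteq> [] \<and> hd w = m \<and> nbr 0 (Max {1..n}) w \<in> {k}}"
    unfolding And_I_eq
  proof (intro Collect_cong conj_cong refl)
    fix w assume w: "w \<in> andre_words Max {1..n}"
    then have "w \<noteq> []" using length_andre_words[OF w] assms(2) by auto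
    then have "F_stat w = hd w" by (cases w) (simp_all add: F_stat_def letter_def)
    then show "((F_stat w, NL_stat w) = (m, k)) \<longleftrightarrow>
        (w \<noteq> [] \<and> hd w = m \<and> nbr 0 (Max {1..n}) w \<in> {k})"
      using \<open>w \<noteq> []\<close> NL_stat_eq_nbr[OF w] assms(2) Max by simp
  qed
  moreover have "{w \<in> And_II n. (L_stat w, grn w) = (m, k)} =
        {w \<in> andre_words Min {1..n}. w \<noteq> [] \<and> last w = m \<and> nbr 0 (Max {1..n}) w \<in> {k}}"
    unfolding And_II_eq
  proof (intro Collect_cong conj_cong refl)
    fix w assume w: "w \<in> andre_words Min {1..n}"
    then have "w \<noteq> []" using length_andre_words[OF w] assms(2) by auto
    then have "L_stat w = last w"
      by (simp add: L_stat_def letter_def last_conv_nth Suc_leI)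
    then show "((L_stat w, grn w) = (m, k)) \<longleftrightarrow>
        (w \<noteq> [] \<and> last w = m \<and> nbr 0 (Max {1..n}) w \<in> {k})"
      using \<open>w \<noteq> []\<close> grn_eq_nbr[OF w] assms(2) Max by simp
  qed
  moreover have "a n m k = A_count n m k \<and> b n m k = B_count n m k"
    using twin_seidel_unique[OF assms(1) twin_seidel_counts assms(2)] assms(3-6) by simp
  ultimately show ?thesis
    unfolding A_count_def B_count_def first_count_def last_count_def by simp
qed

end
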